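(* Let $N\ge2$ and $f=0$, and restrict to real $(w_1,\dots,w_N)$ and $(p_1,\dots,p_N)$, identifying $\mathcal{PF}_N$ with $T^*\mathbb{R}^N$. The Hamiltonian flow of $\widetilde H_0=H|_{\mathcal{PF}_N}$ coincides with the geodesic flow of the metric $g_N$ written on the cotangent bundle $T^*\mathbb{R}^N$; that is, $\widetilde H_0(w,p)=\sum_{j,k=1}^N(\Gamma_N(w))_{jk}p_jp_k=g_N^{-1}(p,p)$. Moreover, the integrals $\widetilde J^0_k=I_k|_{\mathcal{PF}_N}$, $1\le k\le N$, coincide with the integrals $I_{N,k}$ of the geodesic flow of $g_N$ defined by $$\sum_{k=1}^N I_{N,k}(w,p)\,\mu^{k-1}=\det(\mu\,\mathrm{Id}+M_N(w))\,\big\langle(\mu\,\mathrm{Id}+M_N(w))^{-1}\Gamma_N(w)p,\,p\big\rangle_{\mathbb{R}^N},\quad\mu\in\mathbb{R},$$ i.e. $\widetilde J^0_k(w,p)=I_{N,k}(w,p)$ for all $1\le k\le N$.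
   Context: $\mathbb{T}=\mathbb{R}/\mathbb{Z}$, $f_k=\int_0^1 f(y)e^{-2\pi i k y}\,dy$, $\langle k\rangle:=|k|$ for $k\neq0$, $\langle0\rangle:=1$, $e_k(y)=e^{2\pi iky}$. $\mathcal{H}^1$ is the Hilbert space of functions $f:\mathbb{T}\to\mathbb{C}$ with $(\sum_{k}|f_k|^2\langle k\rangle^2)^{1/2}<\infty$. $\mathcal{H}^{1,+}=\{f\in\mathcal{H}^1:f_k=0\text{ for }k<0\}$, $\mathcal{H}^{1,+}_0=\{f\in\mathcal{H}^1:f_k=0\text{ for }k\le0\}$, with Fourier-truncation projections $\Pi^+,\Pi^+_0$; $\langle f,g\rangle=\sum_kf_kg_k$; $\check f(y)=f(-y)$; $(Lf)(y)=f(y)e^{-2\pi iy}$. On $\mathcal{H}^{1,+}_0\times\mathcal{H}^{1,+}_0$: $H(w,p)=\langle w,p^2\rangle$ and, for $k\ge1$, $I_k(w,p)=\langle A_k(w)\Gamma(w)p,p\rangle$ with $A_k(w)g=g\,\Pi^+(L^{k+1}w)-w\,\Pi^+(L^{k+1}g)$ and $\Gamma(w)p=\Pi^+_0(w\check p)$ (these are the Hamiltonian and the integrals for $f=0$). $\mathcal{PF}_N$ consists of pairs $w=w_1e_1+\dots+w_Ne_N+e_{N+1}$, $p=p_1e_1+\dots+p_Ne_N$; its real points are identified with $T^*\mathbb{R}^N$, with positions $(w_1,\dots,w_N)$, momenta $(p_1,\dots,p_N)$, and canonical Poisson structure $\{w_k,w_l\}_N=\{p_k,p_l\}_N=0$,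 $\{p_l,w_k\}_N=\delta_{lk}$. $\Gamma_N(w)$ is the $N\times N$ Hankel matrix with entries $(\Gamma_N(w))_{jk}=w_{j+k}$, where $w_{N+1}:=1$ and $w_l:=0$ for $l>N+1$; it is invertible. $g_N$ is the (pseudo-)Riemannian metric on $\mathbb{R}^N$ with metric tensor $\Gamma_N(w)^{-1}$. Convention: the geodesic flow of $g_N$ written on $T^*\mathbb{R}^N$ is the Hamiltonian flow of $p\mapsto g_N^{-1}(p,p)$. $M_N(w)$ is the $N\times N$ matrix with last column $(w_1,\dots,w_N)^T$, with entries $-1$ on the first subdiagonal (positions $(j+1,j)$, $1\le j\le N-1$), and all other entries $0$. $\langle v,p\rangle_{\mathbb{R}^N}=\sum_jv_jp_j$. The right-hand side of the displayed formula is understood as the adjugate matrix of $\mu\,\mathrm{Id}+M_N(w)$ (hence polynomial in $\mu$ of degree $\le N-1$). *)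

theory Defs
  imports
    "HOL-Analysis.Analysis"
    "Jordan_Normal_Form.Determinant"
    "Jordan_Normal_Form.Gauss_Jordan_Elimination"
begin

unbundle no vec_syntax

text \<open>Functions on the circle are 1-periodic functions of a real variable.\<close>

definition echar :: "int \<Rightarrow> real \<Rightarrow> complex" where
  "echar k y = exp (2 * of_real pi * \<i> * of_int k * of_real y)"

definition fourier :: "(real \<Rightarrow> complex) \<Rightarrow> int \<Rightarrow> complex" where
  "fourier f k = integral {0..1} (\<lambda>y. f y * echar (- k) y)"

definition jb :: "int \<Rightarrow> real" where
  "jb k = (if k = 0 then 1 else of_int \<bar>k\<bar>)"

text \<open>Elements of the Sobolev space are represented by their continuous representatives, so
  that equality of elements is equality of functions.\<close>

definition H1 :: "(real \<Rightarrow> complex) set" where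
  "H1 = {f. continuous_on UNIV f \<and> (\<forall>y. f (y + 1) = f y) \<and>
            (\<lambda>k. (cmod (fourier f k))\<^sup>2 * (jb k)\<^sup>2) summable_on UNIV}"

definition H1_plus0 :: "(real \<Rightarrow> complex) set" where
  "H1_plus0 = {f \<in> H1. \<forall>k\<le>0. fourier f k = 0}"

definition proj_plus :: "(real \<Rightarrow> complex) \<Rightarrow> real \<Rightarrow> complex" where
  "proj_plus f y = (\<Sum>\<^sub>\<infinity>k\<in>{0..}. fourier f k * echar k y)"

definition proj_plus0 :: "(real \<Rightarrow> complex) \<Rightarrow> real \<Rightarrow> complex" where
  "proj_plus0 f y = (\<Sum>\<^sub>\<infinity>k\<in>{1..}. fourier f k * echar k y)"

text \<open>The pairing is bilinear, without complex conjugation.\<close>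

definition pairing :: "(real \<Rightarrow> complex) \<Rightarrow> (real \<Rightarrow> complex) \<Rightarrow> complex" where
  "pairing f g = (\<Sum>\<^sub>\<infinity>k\<in>UNIV. fourier f k * fourier g k)"

definition reflect :: "(real \<Rightarrow> complex) \<Rightarrow> real \<Rightarrow> complex" where
  "reflect f y = f (- y)"

definition shiftL :: "(real \<Rightarrow> complex) \<Rightarrow> real \<Rightarrow> complex" where
  "shiftL f y = f y * echar (- 1) y"

text \<open>The functionals below are meant for arguments in \<^const>\<open>H1_plus0\<close>.\<close>

definition Ham :: "(real \<Rightarrow> complex) \<times> (real \<Rightarrow> complex) \<Rightarrow> complex" where
  "Ham = (\<lambda>(w, p). pairing w (\<lambda>y. (p y)\<^sup>2))"

definition Gam :: "(real \<Rightarrow> complex) \<Rightarrow> (real \<Rightarrow> complex) \<Rightarrow> real \<Rightarrow> complex" where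
  "Gam w p = proj_plus0 (\<lambda>y. w y * reflect p y)"

definition Aop :: "nat \<Rightarrow> (real \<Rightarrow> complex) \<Rightarrow> (real \<Rightarrow> complex) \<Rightarrow> real \<Rightarrow> complex" where
  "Aop k w g y = g y * proj_plus ((shiftL ^^ (k + 1)) w) y
               - w y * proj_plus ((shiftL ^^ (k + 1)) g) y"

definition Iint :: "nat \<Rightarrow> (real \<Rightarrow> complex) \<times> (real \<Rightarrow> complex) \<Rightarrow> complex" where
  "Iint k = (\<lambda>(w, p). pairing (Aop k w (Gam w p)) p)"

text \<open>Vectors are indexed from \<open>0\<close>: the coefficient of \<^term>\<open>echar (int k)\<close> is entry \<open>k - 1\<close>.\<close>

definition PF_point :: "nat \<Rightarrow> complex vec \<times> complex vec
    \<Rightarrow> (real \<Rightarrow> complex) \<times> (real \<Rightarrow> complex)" where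
  "PF_point N = (\<lambda>(a, b).
     ((\<lambda>y. (\<Sum>k=1..N. a $ (k - 1) * echar (int k) y) + echar (int (N + 1)) y),
      (\<lambda>y. \<Sum>k=1..N. b $ (k - 1) * echar (int k) y)))"

definition PF :: "nat \<Rightarrow> ((real \<Rightarrow> complex) \<times> (real \<Rightarrow> complex)) set" where
  "PF N = PF_point N ` (carrier_vec N \<times> carrier_vec N)"

definition PF_real :: "nat \<Rightarrow> ((real \<Rightarrow> complex) \<times> (real \<Rightarrow> complex)) set" where
  "PF_real N = {(w, p) \<in> PF N. \<forall>k. fourier w k \<in> \<real> \<and> fourier p k \<in> \<real>}"

type_synonym phase_point = "real vec \<times> real vec"

definition cotangent :: "nat \<Rightarrow> phase_point set" where
  "cotangent N = carrier_vec N \<times> carrier_vec N"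

definition ident :: "nat \<Rightarrow> phase_point \<Rightarrow> (real \<Rightarrow> complex) \<times> (real \<Rightarrow> complex)" where
  "ident N = (\<lambda>(w, p). PF_point N (map_vec of_real w, map_vec of_real p))"

lemma echar_add: "echar j y * echar k y = echar (j + k) y"
  by (simp add: echar_def exp_add [symmetric] algebra_simps)

lemma continuous_on_echar [continuous_intros]: "continuous_on S (echar k)"
  unfolding echar_def by (intro continuous_intros)

lemma echar_periodic: "echar k (y + 1) = echar k y"
proof -
  have "exp (2 * of_real pi * \<i> * of_int k) = (1 :: complex)"
    using exp_integer_2pi[of "of_int k"] by (simp add: mult_ac)
  thus ?thesis
    by (simp add: echar_def algebra_simps exp_add)
qed

lemma echar_integral: "(echar k has_integral (if k = 0 then 1 else 0)) {0..1}"
proof (cases "k = 0")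
  case True
  have "((\<lambda>y::real. 1 :: complex) has_integral 1) {0..1}"
    using has_integral_const_real[of "1 :: complex" 0 1] by simp
  with True show ?thesis by (simp add: echar_def [abs_def])
next
  case False
  define c where "c = 2 * of_real pi * \<i> * of_int k"
  have c: "c \<noteq> 0" using False by (simp add: c_def)
  have ec: "echar k y = exp (c * of_real y)" for y
    by (simp add: echar_def c_def)
  have "((\<lambda>y. exp (c * of_real y) / c) has_vector_derivative echar k y) (at y within {0..1})" for y
    unfolding ec
    by (rule derivative_eq_intros has_vector_derivative_real_field refl | simp add: c)+
  hence "(echar k has_integral (exp (c * of_real 1) / c - exp (c * of_real 0) / c)) {0..1}"
    by (intro fundamental_theorem_of_calculus) auto
  moreover have "exp (c * of_real 1) = 1"
    using exp_integer_2pi[of "of_int k"] by (simp add: c_def mult_ac)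
  ultimately show ?thesis using False by simp
qed

lemma fourier_trig:
  assumes "finite S"
  shows "fourier (\<lambda>y. \<Sum>j\<in>S. c j * echar j y) k = (if k \<in> S then c k else 0)"
proof -
  have "((\<lambda>y. \<Sum>j\<in>S. c j * echar (j - k) y) has_integral
          (\<Sum>j\<in>S. c j * (if j - k = 0 then 1 else 0))) {0..1}"
    by (intro has_integral_sum assms has_integral_mult_right echar_integral)
  moreover have "(\<Sum>j\<in>S. c j * echar j y) * echar (- k) y = (\<Sum>j\<in>S. c j * echar (j - k) y)" for y
    by (simp add: sum_distrib_right mult.assoc echar_add)
  moreover have "(\<Sum>j\<in>S. c j * (if j - k = 0 then 1 else 0)) = (if k \<in> S then c k else 0)"
    using assms by (simp add: sum.delta' if_distrib [of "\<lambda>x. c _ * x"] cong: if_cong)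
  ultimately show ?thesis
    unfolding fourier_def by (simp add: integral_unique)
qed

lemma trig_H1_plus0:
  assumes "finite S" "\<And>k. k \<in> S \<Longrightarrow> k > 0"
  shows "(\<lambda>y. \<Sum>j\<in>S. c j * echar j y) \<in> H1_plus0"
proof -
  have "(\<lambda>k. (cmod (if k \<in> S then c k else 0))\<^sup>2 * (jb k)\<^sup>2) summable_on UNIV"
    by (rule finite_nonzero_values_imp_summable_on, rule finite_subset[OF _ assms(1)])
       (auto split: if_splits)
  with assms show ?thesis
    unfolding H1_plus0_def H1_def
    by (auto simp: fourier_trig echar_periodic intro!: continuous_intros dest: assms(2))
qed

lemma PF_point_trig:
  "PF_point N (a, b) =
     ((\<lambda>y. \<Sum>j\<in>{1..int N + 1}. (if j = int N + 1 then 1 else a $ (nat j - 1)) * echar j y),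
      (\<lambda>y. \<Sum>j\<in>{1..int N}. b $ (nat j - 1) * echar j y))"
proof -
  have re: "(\<Sum>k=1..N. g (int k)) = (\<Sum>j\<in>{1..int N}. g j)" for g :: "int \<Rightarrow> complex"
    by (rule sum.reindex_bij_witness[of _ nat int]) auto
  have ins: "{1..int N + 1} = insert (int N + 1) {1..int N}" by auto
  have 1: "(\<Sum>k=1..N. v $ (k - 1) * echar (int k) y) =
      (\<Sum>j\<in>{1..int N}. v $ (nat j - 1) * echar j y)" for v y
    using re[of "\<lambda>j. v $ (nat j - 1) * echar j y"] by simp
  have 2: "(\<Sum>j\<in>{1..int N + 1}. (if j = int N + 1 then 1 else a $ (nat j - 1)) * echar j y)
     = (\<Sum>j\<in>{1..int N}. a $ (nat j - 1) * echar j y) + echar (int (N + 1)) y" for y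
  proof -
    have "(\<Sum>j\<in>{1..int N}. (if j = int N + 1 then 1 else a $ (nat j - 1)) * echar j y)
       = (\<Sum>j\<in>{1..int N}. a $ (nat j - 1) * echar j y)"
      by (rule sum.cong) auto
    thus ?thesis unfolding ins by (subst sum.insert) (simp_all add: add.commute)
  qed
  show ?thesis
    unfolding PF_point_def prod.case 1 2 ..
qed

lemma PF_subset: "PF N \<subseteq> H1_plus0 \<times> H1_plus0"
  by (auto simp: PF_def PF_point_trig intro!: trig_H1_plus0)

lemma fourier_PF_point:
  assumes "i < N"
  shows "fourier (fst (PF_point N (a, b))) (int i + 1) = a $ i"
    and "fourier (snd (PF_point N (a, b))) (int i + 1) = b $ i"
  using assms by (auto simp: PF_point_trig fourier_trig nat_add_distrib)

lemma ident_bij: "bij_betw (ident N) (cotangent N) (PF_real N)"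
  unfolding bij_betw_def
proof (intro conjI equalityI subsetI)
  show "inj_on (ident N) (cotangent N)"
  proof (rule inj_onI, clarify)
    fix w p w' p'
    assume A: "(w, p) \<in> cotangent N" "(w', p') \<in> cotangent N" "ident N (w, p) = ident N (w', p')"
    have d: "dim_vec w = N" "dim_vec p = N" "dim_vec w' = N" "dim_vec p' = N"
      using A by (auto simp: cotangent_def)
    have "w $ i = w' $ i \<and> p $ i = p' $ i" if "i < N" for i
      using fourier_PF_point[OF that, of "map_vec of_real w" "map_vec of_real p"]
        fourier_PF_point[OF that, of "map_vec of_real w'" "map_vec of_real p'"] A(3) that d
      by (simp add: ident_def)
    thus "w = w' \<and> p = p'" using d by (auto intro!: eq_vecI)
  qed
next
  fix z assume "z \<in> ident N ` cotangent N"
  then obtain w p where z: "z = ident N (w, p)" "w \<in> carrier_vec N" "p \<in> carrier_vec N"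
    by (auto simp: cotangent_def)
  thus "z \<in> PF_real N"
    by (force simp: PF_real_def PF_def ident_def PF_point_trig fourier_trig image_iff)
next
  fix z assume "z \<in> PF_real N"
  then obtain a b where z: "z = PF_point N (a, b)" "a \<in> carrier_vec N" "b \<in> carrier_vec N"
    and r: "\<And>k. fourier (fst z) k \<in> \<real>" "\<And>k. fourier (snd z) k \<in> \<real>"
    unfolding PF_real_def PF_def by (auto) (metis fst_conv snd_conv)
  have "a $ i \<in> \<real> \<and> b $ i \<in> \<real>" if "i < N" for i
    using fourier_PF_point[OF that, of a b] r[of "int i + 1"] z by simp
  hence "map_vec of_real (map_vec Re a) = a" "map_vec of_real (map_vec Re b) = b"
    using z by (auto intro!: eq_vecI)
  hence "z = ident N (map_vec Re a, map_vec Re b)"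
    using z by (simp add: ident_def)
  thus "z \<in> ident N ` cotangent N"
    using z by (auto simp: cotangent_def)
qed

text \<open>The real part only serves to obtain a real-valued function: the functionals are real on
  \<^term>\<open>PF_real N\<close>.\<close>

definition H_tilde :: "nat \<Rightarrow> phase_point \<Rightarrow> real" where
  "H_tilde N x = Re (Ham (ident N x))"

definition d_pos :: "nat \<Rightarrow> nat \<Rightarrow> (phase_point \<Rightarrow> real) \<Rightarrow> phase_point \<Rightarrow> real" where
  "d_pos N l F = (\<lambda>(w, p). deriv (\<lambda>s. F (w + s \<cdot>\<^sub>v unit_vec N l, p)) 0)"

definition d_mom :: "nat \<Rightarrow> nat \<Rightarrow> (phase_point \<Rightarrow> real) \<Rightarrow> phase_point \<Rightarrow> real" where
  "d_mom N l F = (\<lambda>(w, p). deriv (\<lambda>s. F (w, p + s \<cdot>\<^sub>v unit_vec N l)) 0)"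

definition poisson :: "nat \<Rightarrow> (phase_point \<Rightarrow> real) \<Rightarrow> (phase_point \<Rightarrow> real)
    \<Rightarrow> phase_point \<Rightarrow> real" where
  "poisson N F G x =
     (\<Sum>l<N. d_mom N l F x * d_pos N l G x - d_pos N l F x * d_mom N l G x)"

lemma deriv_affine: "deriv (\<lambda>s. a + s * b) 0 = (b :: real)"
  by (rule DERIV_imp_deriv) (auto intro!: derivative_eq_intros)

lemma canonical_brackets:
  assumes "x \<in> cotangent N" "k < N" "l < N"
  shows "poisson N (\<lambda>z. snd z $ l) (\<lambda>z. fst z $ k) x = (if k = l then 1 else 0)"
    and "poisson N (\<lambda>z. fst z $ l) (\<lambda>z. fst z $ k) x = 0"
    and "poisson N (\<lambda>z. snd z $ l) (\<lambda>z. snd z $ k) x = 0"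
proof -
  obtain w p where x: "x = (w, p)" "dim_vec w = N" "dim_vec p = N"
    using assms(1) by (auto simp: cotangent_def)
  have d: "d_pos N i (\<lambda>z. fst z $ j) x = (if i = j then 1 else 0)"
     "d_mom N i (\<lambda>z. snd z $ j) x = (if i = j then 1 else 0)"
     "d_pos N i (\<lambda>z. snd z $ j) x = 0" "d_mom N i (\<lambda>z. fst z $ j) x = 0"
     if "i < N" "j < N" for i j
    using that x deriv_affine by (auto simp: d_pos_def d_mom_def unit_vec_def)
  show "poisson N (\<lambda>z. snd z $ l) (\<lambda>z. fst z $ k) x = (if k = l then 1 else 0)"
    "poisson N (\<lambda>z. fst z $ l) (\<lambda>z. fst z $ k) x = 0"
    "poisson N (\<lambda>z. snd z $ l) (\<lambda>z. snd z $ k) x = 0"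
    using assms by (simp_all add: poisson_def d sum.delta if_distrib [of "\<lambda>x. x * _"] cong: if_cong)
qed

text \<open>The (local) flow is given by its graph: \<open>(t, x, y)\<close> belongs to the flow of \<open>F\<close> iff the
  solution of \<open>w' = {F, w}\<close>, \<open>p' = {F, p}\<close> starting at \<open>x\<close> exists up to time \<open>t\<close> and is at
  \<open>y\<close> then.\<close>

definition hamiltonian_flow :: "nat \<Rightarrow> (phase_point \<Rightarrow> real)
    \<Rightarrow> (real \<times> phase_point \<times> phase_point) set" where
  "hamiltonian_flow N F = {(t, x, y). \<exists>J \<gamma>.
     open J \<and> is_interval J \<and> 0 \<in> J \<and> t \<in> J \<and> \<gamma> 0 = x \<and> \<gamma> t = y \<and>
     (\<forall>s\<in>J. \<gamma> s \<in> cotangent N \<and>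
       (\<forall>i<N.
         ((\<lambda>s. fst (\<gamma> s) $ i) has_real_derivative poisson N F (\<lambda>z. fst z $ i) (\<gamma> s)) (at s) \<and>
         ((\<lambda>s. snd (\<gamma> s) $ i) has_real_derivative poisson N F (\<lambda>z. snd z $ i) (\<gamma> s)) (at s)))}"

definition first_integral :: "(real \<times> phase_point \<times> phase_point) set
    \<Rightarrow> (phase_point \<Rightarrow> real) \<Rightarrow> bool" where
  "first_integral \<Phi> F \<longleftrightarrow> (\<forall>(t, x, y)\<in>\<Phi>. F y = F x)"

definition w_ext :: "nat \<Rightarrow> real vec \<Rightarrow> nat \<Rightarrow> real" where
  "w_ext N w l = (if 1 \<le> l \<and> l \<le> N then w $ (l - 1) else if l = N + 1 then 1 else 0)"

definition hankel :: "nat \<Rightarrow> real vec \<Rightarrow> real mat" where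
  "hankel N w = mat N N (\<lambda>(j, k). w_ext N w ((j + 1) + (k + 1)))"

definition metric_tensor :: "nat \<Rightarrow> real vec \<Rightarrow> real mat" where
  "metric_tensor N w = the (mat_inverse (hankel N w))"

definition cometric :: "nat \<Rightarrow> phase_point \<Rightarrow> real" where
  "cometric N = (\<lambda>(w, p). (the (mat_inverse (metric_tensor N w)) *\<^sub>v p) \<bullet> p)"

lemma hankel_det_nonzero: "det (hankel N w) \<noteq> 0"
proof
  assume "det (hankel N w) = 0"
  moreover have H: "hankel N w \<in> carrier_mat N N" by (simp add: hankel_def)
  ultimately obtain v where v: "v \<in> carrier_vec N" "v \<noteq> 0\<^sub>v N" "hankel N w *\<^sub>v v = 0\<^sub>v N"
    using det_0_iff_vec_prod_zero_field by blast
  have "v $ i = 0" if "i < N" for i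
    using that
  proof (induction i rule: less_induct)
    case (less i)
    have "(hankel N w *\<^sub>v v) $ (N - 1 - i) = 0" using v(3) less.prems by simp
    hence "0 = (\<Sum>j<N. w_ext N w (N - i + (j + 1)) * v $ j)"
      using v(1) less.prems
      by (simp add: hankel_def scalar_prod_def Suc_diff_Suc row_def atLeast0LessThan)
    also have "\<dots> = (\<Sum>j<N. if j = i then v $ i else 0)"
    proof (rule sum.cong)
      fix j assume "j \<in> {..<N}"
      with less show "w_ext N w (N - i + (j + 1)) * v $ j = (if j = i then v $ i else 0)"
        by (cases j i rule: linorder_cases) (auto simp: w_ext_def)
    qed simp
    finally show ?case using less.prems by simp
  qed
  with v show False by (auto intro: eq_vecI)
qed

lemma metric_tensor_inverse:
  "metric_tensor N w \<in> carrier_mat N N"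
  "hankel N w * metric_tensor N w = 1\<^sub>m N" "metric_tensor N w * hankel N w = 1\<^sub>m N"
proof -
  have H: "hankel N w \<in> carrier_mat N N" by (simp add: hankel_def)
  have "hankel N w \<in> Units (ring_mat TYPE(real) N ())"
    by (rule det_non_zero_imp_unit[OF H hankel_det_nonzero])
  then obtain B where B: "mat_inverse (hankel N w) = Some B"
    using mat_inverse(1)[OF H, of "()"] by (cases "mat_inverse (hankel N w)") auto
  show "metric_tensor N w \<in> carrier_mat N N"
    "hankel N w * metric_tensor N w = 1\<^sub>m N" "metric_tensor N w * hankel N w = 1\<^sub>m N"
    using mat_inverse(2)[OF H B] by (simp_all add: metric_tensor_def B)
qed

text \<open>With this normalization (no factor \<open>1/2\<close>) geodesics run at twice the usual speed.\<close>

definition geodesic_flow :: "nat \<Rightarrow> (real \<times> phase_point \<times> phase_point) set" where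
  "geodesic_flow N = hamiltonian_flow N (cometric N)"

definition Mmat :: "nat \<Rightarrow> real vec \<Rightarrow> real mat" where
  "Mmat N w = mat N N (\<lambda>(i, j). if j = N - 1 then w $ i else if i = j + 1 then - 1 else 0)"

text \<open>\<open>det (\<mu> Id + M) \<langle>(\<mu> Id + M)\<^sup>-\<^sup>1 \<Gamma> p, p\<rangle>\<close>, where the determinant times the inverse
  is read as the adjugate matrix, so that singular \<open>\<mu> Id + M\<close> is covered.\<close>

definition gen_fun :: "nat \<Rightarrow> phase_point \<Rightarrow> real \<Rightarrow> real" where
  "gen_fun N = (\<lambda>(w, p) \<mu>.
     (adj_mat (\<mu> \<cdot>\<^sub>m 1\<^sub>m N + Mmat N w) *\<^sub>v (hankel N w *\<^sub>v p)) \<bullet> p)"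

definition geo_integral :: "nat \<Rightarrow> nat \<Rightarrow> phase_point \<Rightarrow> real" where
  "geo_integral N k x = (THE c :: nat \<Rightarrow> real.
     (\<forall>k. k \<notin> {1..N} \<longrightarrow> c k = 0) \<and>
     (\<forall>\<mu>. (\<Sum>k=1..N. c k * \<mu> ^ (k - 1)) = gen_fun N x \<mu>)) k"

end

theory Submission
  imports Defs
begin

text \<open>Let \<open>g\<close> be the coefficient sequence of \<open>\<Gamma>(w) p\<close>. The coefficients of \<open>A\<^sub>k(w) g\<close>, \<open>k \<ge> 1\<close>, form
  the Bezoutian of \<open>w\<close> and \<open>g\<close>, with generating function \<open>(g(z) w(\<mu>) - w(z) g(\<mu>)) / (\<mu> - z)\<close>. Since
  \<open>\<mu> + M\<^sub>N(w)\<close> represents multiplication by \<open>\<mu> - z\<close> modulo \<open>w(z) / z\<close> and has determinant \<open>w(\<mu>) / \<mu>\<close>,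
  it maps the Bezoutian to its determinant times \<open>g\<close>, which identifies the two families of
  integrals where the determinant is nonzero, hence everywhere by continuity. The symmetry of the
  Bezoutian gives \<open>\<Sum>\<^sub>k I\<^sub>k \<mu>\<^sup>k = (g(\<mu>)\<^sup>2 - w(\<mu>) h(\<mu>)) / \<mu>\<close> with \<open>h\<close> the coefficients of \<open>\<Gamma>(g) p\<close>. This is
  conserved because \<open>w' = 2 g\<close>, \<open>g' = h\<close> and \<open>h' = 0\<close> along the flow.\<close>

subsection \<open>The Bezoutian\<close>

text \<open>The reflection \<open>i \<mapsto> n + k + 1 - i\<close> reverses the sign of every term,
  so the sum over \<open>1..n + k\<close> vanishes and its tail beyond \<open>n\<close> is minus the
  sum of the first \<open>k\<close> terms. This is the source of the symmetry of the
  Bezoutian.\<close>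

lemma sum_antisym_symmetric:
  fixes a :: "nat \<Rightarrow> nat \<Rightarrow> real"
  assumes anti: "\<And>i j. a j i = - a i j"
  shows "(\<Sum>i=1..n. a i (n + k + 1 - i)) = (\<Sum>i=1..k. a i (n + k + 1 - i))"
proof -
  have "(\<Sum>i=1..n + k. a i (n + k + 1 - i)) = (\<Sum>i=1..n + k. a (n + k + 1 - i) i)"
    by (rule sum.reindex_bij_witness[of _ "\<lambda>i. n + k + 1 - i" "\<lambda>i. n + k + 1 - i"]) auto
  hence 0: "(\<Sum>i=1..n + k. a i (n + k + 1 - i)) = 0"
    by (simp add: anti[of "_ - _"] sum_negf)
  have "(\<Sum>i=n + 1..n + k. a i (n + k + 1 - i)) = (\<Sum>i=1..k. a (n + k + 1 - i) i)"
    by (rule sum.reindex_bij_witness[of _ "\<lambda>i. n + k + 1 - i" "\<lambda>i. n + k + 1 - i"]) auto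
  also have "\<dots> = - (\<Sum>i=1..k. a i (n + k + 1 - i))"
    by (simp add: anti[of "_ - _"] sum_negf)
  finally have 1: "(\<Sum>i=n + 1..n + k. a i (n + k + 1 - i)) = - (\<Sum>i=1..k. a i (n + k + 1 - i))" .
  have "(\<Sum>i=1..n + k. a i (n + k + 1 - i)) =
      (\<Sum>i=1..n. a i (n + k + 1 - i)) + (\<Sum>i=n + 1..n + k. a i (n + k + 1 - i))"
    by (rule sum.ub_add_nat) simp
  with 0 1 show ?thesis by simp
qed

text \<open>Substituting \<open>k = a + b\<close> is legitimate although natural subtraction
  truncates: for \<open>k \<le> a\<close> the factor is \<open>v 0 = 0\<close>.\<close>

lemma sum_truncated_shift:
  fixes u v :: "nat \<Rightarrow> 'a :: semiring_0"
  assumes "v 0 = 0" "\<And>b. b > K \<Longrightarrow> v b = 0" "\<And>m. m > M \<Longrightarrow> u m = 0"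
  shows "(\<Sum>k=1..M. u k * v (k - a)) = (\<Sum>b=1..K. u (a + b) * v b)"
proof -
  have "(\<Sum>k=1..M. u k * v (k - a)) = (\<Sum>k=1 + a..K + a. u k * v (k - a))"
  proof (rule sum.mono_neutral_cong)
    fix k assume k: "k \<in> {1..M} - {1 + a..K + a}"
    hence "k - a = 0 \<or> k - a > K" by auto
    with assms show "u k * v (k - a) = 0" by auto
  qed (use assms in auto)
  also have "\<dots> = (\<Sum>b=1..K. u (a + b) * v b)"
    unfolding sum.shift_bounds_cl_nat_ivl by (simp add: add.commute)
  finally show ?thesis .
qed

text \<open>The coefficients of \<open>\<Pi>\<^sup>+\<^sub>0\<close> applied to the product of \<open>u\<close> with the reflection of \<open>p\<close>.\<close>

definition contract :: "nat \<Rightarrow> (nat \<Rightarrow> real) \<Rightarrow> (nat \<Rightarrow> real) \<Rightarrow> nat \<Rightarrow> real" where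
  "contract N p u j = (if j = 0 then 0 else \<Sum>n=1..N. p n * u (j + n))"

text \<open>The contracted index is at least 1, so the support shrinks from \<open>N + 1\<close> to
  \<open>N\<close>; for \<open>u = w\<close> this makes the degree of g smaller than that of
  w.\<close>

lemma contract_vanish:
  assumes "\<And>m. m > N + 1 \<Longrightarrow> u m = 0" "j > N"
  shows "contract N p u j = 0"
  using assms by (auto simp: contract_def intro!: sum.neutral)

text \<open>The left multiplier consists of the coefficients of \<open>p\<^sup>2\<close>. Cutting
  them off at \<open>N\<close> is harmless: for \<open>j \<ge> 1\<close> and \<open>n > N\<close>
  the entry \<open>u (j + n)\<close> vanishes.\<close>

lemma contract_convolution:
  assumes "p 0 = 0" "\<And>b. b > N \<Longrightarrow> p b = 0" "\<And>m. m > N + 1 \<Longrightarrow> u m = 0"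
  shows "contract N (\<lambda>n. \<Sum>a=1..N. p a * p (n - a)) u j = contract N p (contract N p u) j"
proof (cases "j = 0")
  case False
  have "(\<Sum>n=1..N. (\<Sum>a=1..N. p a * p (n - a)) * u (j + n))
      = (\<Sum>a=1..N. p a * (\<Sum>n=1..N. u (j + n) * p (n - a)))"
    by (simp add: sum_distrib_left sum_distrib_right mult_ac) (rule sum.swap)
  also have "\<dots> = (\<Sum>a=1..N. p a * (\<Sum>b=1..N. u (j + (a + b)) * p b))"
    by (intro sum.cong refl arg_cong[of _ _ "(*) _"] sum_truncated_shift)
       (use assms False in auto)
  finally show ?thesis using False by (simp add: contract_def mult.commute add.assoc)
qed (simp add: contract_def)

text \<open>The coefficients of the Bezoutian \<open>(g(z) w(\<mu>) - w(z) g(\<mu>)) / (\<mu> - z)\<close>; column \<open>k\<close> is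
  \<open>A\<^sub>k(w) g\<close>.\<close>

definition bezout :: "(nat \<Rightarrow> real) \<Rightarrow> (nat \<Rightarrow> real) \<Rightarrow> nat \<Rightarrow> nat \<Rightarrow> real" where
  "bezout w g k n = (\<Sum>i=1..k. g i * w (n + k + 1 - i) - w i * g (n + k + 1 - i))"

text \<open>Exchanging z and mu reverses the sign of both numerator and denominator.\<close>

lemma bezout_sym: "bezout w g k n = bezout w g n k"
  unfolding bezout_def
  using sum_antisym_symmetric[of "\<lambda>i j. g i * w j - w i * g j" n k]
  by (simp add: mult.commute add.commute)

lemma bezout_0 [simp]: "bezout w g 0 n = 0" "bezout w g n 0 = 0"
  by (simp_all add: bezout_sym[of _ _ n 0]) (simp_all add: bezout_def)

text \<open>This compares coefficients of mu^k z^n after multiplying the Bezoutian by mu - z: the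
  two sums on the left share all terms but \<open>i = k\<close>.\<close>

lemma bezout_rec:
  assumes "k \<ge> 1" "n \<ge> 1"
  shows "bezout w g (k - 1) n - bezout w g k (n - 1) = g n * w k - w n * g k"
proof -
  obtain k' n' where "k = Suc k'" "n = Suc n'"
    using assms by (metis Suc_le_D One_nat_def)
  thus ?thesis by (simp add: bezout_def algebra_simps)
qed

text \<open>Since \<open>w\<close> is monic of degree \<open>N + 1\<close> and \<open>g\<close> has
  degree at most \<open>N\<close>, the terms with \<open>i < k\<close> reach beyond both supports,
  and only \<open>g k * w (N + 1)\<close> remains.\<close>

lemma bezout_last:
  assumes "k \<ge> 1" "w (N + 1) = 1" "\<And>m. m > N + 1 \<Longrightarrow> w m = 0" "\<And>m. m > N \<Longrightarrow> g m = 0"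
  shows "bezout w g k N = g k"
proof (cases k)
  case (Suc k')
  have "(\<Sum>i=1..k'. g i * w (N + k + 1 - i) - w i * g (N + k + 1 - i)) = 0"
    using assms Suc by (intro sum.neutral) auto
  thus ?thesis using assms Suc by (simp add: bezout_def)
qed (use assms in simp)

text \<open>These are the integrals I_k in coefficients, see \<open>Iint_has_coeffs\<close>.\<close>

definition integral_fn :: "nat \<Rightarrow> (nat \<Rightarrow> real) \<Rightarrow> (nat \<Rightarrow> real) \<Rightarrow> nat \<Rightarrow> real" where
  "integral_fn N w p k = (\<Sum>n=1..N. p n * bezout w (contract N p w) k n)"

text \<open>The index \<open>n\<close> enters only through w and g at \<open>n + k + 1 - i\<close>,
  so pairing with \<open>p\<close> turns w into g and g into h = \<open>contract N p g\<close>. For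
  \<open>w 0 = 0\<close> the result is the coefficient of mu^(k+1) in g^2 - w h.\<close>

lemma integral_fn_closed_form:
  "integral_fn N w p k = (\<Sum>i=1..k. contract N p w i * contract N p w (k + 1 - i)
     - w i * contract N p (contract N p w) (k + 1 - i))"
proof -
  let ?g = "contract N p w"
  have "integral_fn N w p k
     = (\<Sum>i=1..k. \<Sum>n=1..N. p n * (?g i * w (n + k + 1 - i) - w i * ?g (n + k + 1 - i)))"
    unfolding integral_fn_def bezout_def sum_distrib_left by (rule sum.swap)
  also have "\<dots> = (\<Sum>i=1..k. ?g i * contract N p w (k + 1 - i)
      - w i * contract N p ?g (k + 1 - i))"
  proof (rule sum.cong[OF refl])
    fix i assume i: "i \<in> {1..k}"
    \<comment> \<open>Here \<open>k + 1 - i\<close> is at least 1, away from the index 0 at which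
      \<open>contract\<close> is zero by default.\<close>
    have "n + k + 1 - i = (k + 1 - i) + n" for n using i by auto
    thus "(\<Sum>n=1..N. p n * (?g i * w (n + k + 1 - i) - w i * ?g (n + k + 1 - i)))
       = ?g i * contract N p w (k + 1 - i) - w i * contract N p ?g (k + 1 - i)"
      using i unfolding contract_def[of N p _ "k + 1 - i"]
      by (auto simp: sum_subtractf sum_distrib_left right_diff_distrib mult_ac)
  qed
  finally show ?thesis .
qed

subsection \<open>Finite Fourier series\<close>

text \<open>The components of points of PF_N are trigonometric polynomials, and this class is closed
  under all operations in the functionals; finite support reduces integrals and infinite sums to
  finite algebra.\<close>

definition has_coeffs :: "(real \<Rightarrow> complex) \<Rightarrow> (int \<Rightarrow> complex) \<Rightarrow> bool" where
  "has_coeffs f c \<longleftrightarrow> finite {k. c k \<noteq> 0} \<and> (\<forall>y. f y = (\<Sum>k | c k \<noteq> 0. c k * echar k y))"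

lemma has_coeffsI:
  assumes "finite S" "\<And>k. k \<notin> S \<Longrightarrow> c k = 0" "\<And>y. f y = (\<Sum>k\<in>S. c k * echar k y)"
  shows "has_coeffs f c"
proof -
  have sub: "{k. c k \<noteq> 0} \<subseteq> S" using assms(2) by auto
  have "(\<Sum>k\<in>S. c k * echar k y) = (\<Sum>k | c k \<noteq> 0. c k * echar k y)" for y
    using sub assms(1) by (intro sum.mono_neutral_right) auto
  with assms sub show ?thesis by (auto simp: has_coeffs_def intro: finite_subset)
qed

lemma has_coeffs_finite: "has_coeffs f c \<Longrightarrow> finite {k. c k \<noteq> 0}"
  by (simp add: has_coeffs_def)

lemma has_coeffs_fourier:
  assumes "has_coeffs f c"
  shows "fourier f k = c k"
proof -
  have "f = (\<lambda>y. \<Sum>k | c k \<noteq> 0. c k * echar k y)" "finite {k. c k \<noteq> 0}"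
    using assms by (auto simp: has_coeffs_def)
  thus ?thesis using fourier_trig[of "{k. c k \<noteq> 0}" c k] by simp
qed

text \<open>Both projections and the pairing are instances, with \<open>h\<close> given by
  characters or by the Fourier coefficients of the second argument.\<close>

lemma infsum_fourier:
  assumes "has_coeffs f c"
  shows "(\<Sum>\<^sub>\<infinity>k\<in>A. fourier f k * h k) = (\<Sum>k | c k \<noteq> 0 \<and> k \<in> A. c k * h k)"
proof -
  have "(\<Sum>\<^sub>\<infinity>k\<in>A. fourier f k * h k) = (\<Sum>\<^sub>\<infinity>k\<in>{k. c k \<noteq> 0 \<and> k \<in> A}. c k * h k)"
    by (rule infsum_cong_neutral) (auto simp: has_coeffs_fourier[OF assms])
  also have "\<dots> = (\<Sum>k | c k \<noteq> 0 \<and> k \<in> A. c k * h k)"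
    by (rule infsum_finite) (use has_coeffs_finite[OF assms] in simp)
  finally show ?thesis .
qed

lemma has_coeffs_restrict:
  assumes "has_coeffs f c"
  shows "has_coeffs (\<lambda>y. \<Sum>\<^sub>\<infinity>k\<in>A. fourier f k * echar k y) (\<lambda>k. if k \<in> A then c k else 0)"
  by (rule has_coeffsI[of "{k. c k \<noteq> 0 \<and> k \<in> A}"])
     (use has_coeffs_finite[OF assms] in \<open>auto simp: infsum_fourier[OF assms] intro!: sum.cong\<close>)

lemma has_coeffs_proj_plus:
  "has_coeffs f c \<Longrightarrow> has_coeffs (proj_plus f) (\<lambda>k. if k \<ge> 0 then c k else 0)"
  using has_coeffs_restrict[of f c "{0..}"] by (simp add: proj_plus_def[abs_def])

lemma has_coeffs_proj_plus0:
  "has_coeffs f c \<Longrightarrow> has_coeffs (proj_plus0 f) (\<lambda>k. if k \<ge> 1 then c k else 0)"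
  using has_coeffs_restrict[of f c "{1..}"] by (simp add: proj_plus0_def[abs_def])

lemma pairing_has_coeffs:
  assumes "has_coeffs f c" "has_coeffs g d"
  shows "pairing f g = (\<Sum>k | c k \<noteq> 0. c k * d k)"
  unfolding pairing_def using infsum_fourier[OF assms(1), where A = UNIV and h = "fourier g"]
  by (simp add: has_coeffs_fourier[OF assms(2)])

lemma has_coeffs_reflect:
  assumes "has_coeffs f c"
  shows "has_coeffs (reflect f) (\<lambda>k. c (- k))"
proof (rule has_coeffsI[of "uminus ` {k. c k \<noteq> 0}"])
  show "c (- k) = 0" if "k \<notin> uminus ` {k. c k \<noteq> 0}" for k
    using that by (auto simp: image_iff)
  show "reflect f y = (\<Sum>k\<in>uminus ` {k. c k \<noteq> 0}. c (- k) * echar k y)" for y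
    using assms by (subst sum.reindex) (auto simp: has_coeffs_def reflect_def echar_def inj_on_def)
qed (use has_coeffs_finite[OF assms] in auto)

lemma has_coeffs_shiftL:
  assumes "has_coeffs f c"
  shows "has_coeffs (shiftL f) (\<lambda>k. c (k + 1))"
proof (rule has_coeffsI[of "(\<lambda>k. k - 1) ` {k. c k \<noteq> 0}"])
  show "c (k + 1) = 0" if "k \<notin> (\<lambda>k. k - 1) ` {k. c k \<noteq> 0}" for k
    using that by (auto simp: image_iff)
  show "shiftL f y = (\<Sum>k\<in>(\<lambda>k. k - 1) ` {k. c k \<noteq> 0}. c (k + 1) * echar k y)" for y
    using assms by (subst sum.reindex)
      (auto simp: has_coeffs_def shiftL_def inj_on_def sum_distrib_right mult.assoc echar_add)
qed (use has_coeffs_finite[OF assms] in auto)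

lemma has_coeffs_shiftL_funpow:
  "has_coeffs f c \<Longrightarrow> has_coeffs ((shiftL ^^ m) f) (\<lambda>k. c (k + int m))"
proof (induction m)
  case (Suc m)
  from has_coeffs_shiftL[OF Suc.IH[OF Suc.prems]] show ?case by (simp add: algebra_simps)
qed simp

lemma has_coeffs_diff:
  assumes "has_coeffs f c" "has_coeffs g d"
  shows "has_coeffs (\<lambda>y. f y - g y) (\<lambda>k. c k - d k)"
proof (rule has_coeffsI[of "{k. c k \<noteq> 0} \<union> {k. d k \<noteq> 0}"])
  have fin: "finite {k. c k \<noteq> 0}" "finite {k. d k \<noteq> 0}"
    using assms by (auto simp: has_coeffs_def)
  thus "finite ({k. c k \<noteq> 0} \<union> {k. d k \<noteq> 0})" by simp
  fix y
  have "f y = (\<Sum>k\<in>{k. c k \<noteq> 0} \<union> {k. d k \<noteq> 0}. c k * echar k y)"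
    using assms fin by (auto simp: has_coeffs_def intro!: sum.mono_neutral_left)
  moreover have "g y = (\<Sum>k\<in>{k. c k \<noteq> 0} \<union> {k. d k \<noteq> 0}. d k * echar k y)"
    using assms fin by (auto simp: has_coeffs_def intro!: sum.mono_neutral_left)
  ultimately show "f y - g y = (\<Sum>k\<in>{k. c k \<noteq> 0} \<union> {k. d k \<noteq> 0}. (c k - d k) * echar k y)"
    by (simp add: sum_subtractf left_diff_distrib)
qed auto

lemma has_coeffs_mult:
  assumes "has_coeffs f c" "has_coeffs g d"
  shows "has_coeffs (\<lambda>y. f y * g y) (\<lambda>k. \<Sum>j | c j \<noteq> 0. c j * d (k - j))"
proof -
  define S T where "S = {k. c k \<noteq> 0}" and "T = {k. d k \<noteq> 0}"
  define U where "U = (\<lambda>(j, l). j + l) ` (S \<times> T)"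
  have fin: "finite S" "finite T" "finite U"
    using assms by (auto simp: has_coeffs_def S_def T_def U_def)
  have "has_coeffs (\<lambda>y. f y * g y) (\<lambda>k. \<Sum>j\<in>S. c j * d (k - j))"
  proof (rule has_coeffsI[OF fin(3)])
    fix k assume k: "k \<notin> U"
    show "(\<Sum>j\<in>S. c j * d (k - j)) = 0"
    proof (rule sum.neutral, rule ballI)
      fix j assume "j \<in> S"
      with k have "k - j \<notin> T" unfolding U_def by force
      thus "c j * d (k - j) = 0" by (simp add: T_def)
    qed
  next
    fix y
    \<comment> \<open>Extending the range from \<open>j + T\<close> to the sumset \<open>U\<close>
      adds only terms with \<open>d (k - j) = 0\<close> and makes it independent of
      \<open>j\<close>.\<close>
    have 1: "(\<Sum>k\<in>U. d (k - j) * echar k y) = (\<Sum>l\<in>T. d l * echar (j + l) y)"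
      if j: "j \<in> S" for j
    proof -
      have "(\<Sum>l\<in>T. d l * echar (j + l) y) = (\<Sum>k\<in>(+) j ` T. d (k - j) * echar k y)"
        by (subst sum.reindex) auto
      also have "\<dots> = (\<Sum>k\<in>U. d (k - j) * echar k y)"
      proof (rule sum.mono_neutral_left[OF fin(3)])
        show "(+) j ` T \<subseteq> U" using j unfolding U_def by force
        show "\<forall>k\<in>U - (+) j ` T. d (k - j) * echar k y = 0"
        proof
          fix k assume "k \<in> U - (+) j ` T"
          hence "k - j \<notin> T" by (metis DiffD2 diff_add_cancel imageI add.commute)
          thus "d (k - j) * echar k y = 0" by (simp add: T_def)
        qed
      qed
      finally show ?thesis ..
    qed
    have "f y * g y = (\<Sum>j\<in>S. c j * echar j y) * (\<Sum>l\<in>T. d l * echar l y)"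
      using assms by (simp add: has_coeffs_def S_def T_def)
    also have "\<dots> = (\<Sum>j\<in>S. c j * (\<Sum>l\<in>T. d l * echar (j + l) y))"
      unfolding sum_product by (simp add: sum_distrib_left echar_add[symmetric] mult_ac)
    also have "\<dots> = (\<Sum>j\<in>S. c j * (\<Sum>k\<in>U. d (k - j) * echar k y))"
      using 1 by simp
    also have "\<dots> = (\<Sum>k\<in>U. (\<Sum>j\<in>S. c j * d (k - j)) * echar k y)"
      by (simp add: sum_distrib_left sum_distrib_right mult_ac) (rule sum.swap)
    finally show "f y * g y = (\<Sum>k\<in>U. (\<Sum>j\<in>S. c j * d (k - j)) * echar k y)" .
  qed
  thus ?thesis by (simp add: S_def)
qed

text \<open>Since \<open>nat\<close> sends negative frequencies to 0, the condition
  \<open>u 0 = 0\<close> is what makes the spectrum strictly positive.\<close>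

definition nat_coeffs :: "(nat \<Rightarrow> real) \<Rightarrow> int \<Rightarrow> complex" where
  "nat_coeffs u k = of_real (u (nat k))"

lemma nat_coeffs_supp:
  assumes "u 0 = 0" "\<And>m. m > K \<Longrightarrow> u m = 0" "nat_coeffs u k \<noteq> 0"
  shows "k \<in> int ` {1..K}"
proof -
  have "u (nat k) \<noteq> 0" using assms(3) by (simp add: nat_coeffs_def)
  hence "nat k \<noteq> 0" "nat k \<le> K" using assms(1,2) by (metis, metis not_le)
  thus ?thesis by (auto intro!: image_eqI[of _ _ "nat k"])
qed

lemma sum_nat_coeffs:
  assumes "u 0 = 0" "\<And>m. m > K \<Longrightarrow> u m = 0"
  shows "(\<Sum>k | nat_coeffs u k \<noteq> 0. nat_coeffs u k * F k)
    = (\<Sum>k=1..K. of_real (u k) * F (int k))"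
proof -
  have "(\<Sum>k | nat_coeffs u k \<noteq> 0. nat_coeffs u k * F k)
      = (\<Sum>k\<in>int ` {1..K}. nat_coeffs u k * F k)"
    using nat_coeffs_supp[of u K] assms by (intro sum.mono_neutral_left) auto
  also have "\<dots> = (\<Sum>k=1..K. of_real (u k) * F (int k))"
    by (subst sum.reindex) (auto simp: nat_coeffs_def)
  finally show ?thesis .
qed

lemma has_coeffs_nat_coeffs:
  assumes "u 0 = 0" "\<And>m. m > K \<Longrightarrow> u m = 0"
  shows "has_coeffs (\<lambda>y. \<Sum>k=1..K. of_real (u k) * echar (int k) y) (nat_coeffs u)"
proof (rule has_coeffsI[of "int ` {1..K}"])
  show "nat_coeffs u k = 0" if "k \<notin> int ` {1..K}" for k
    using nat_coeffs_supp[of u K k] assms that by blast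
qed (auto simp: sum.reindex nat_coeffs_def)

section \<open>Coefficient formulas for the operators and functionals\<close>

lemma has_coeffs_square:
  assumes "has_coeffs f (nat_coeffs u)" "u 0 = 0" "\<And>m. m > K \<Longrightarrow> u m = 0"
  shows "has_coeffs (\<lambda>y. (f y)\<^sup>2)
    (\<lambda>k. \<Sum>a=1..K. of_real (u a) * nat_coeffs u (k - int a))"
  using has_coeffs_mult[OF assms(1,1)] sum_nat_coeffs[of u K] assms(2,3)
  by (simp add: power2_eq_square)

text \<open>Reflecting the second factor turns the convolution into a correlation, and the default 0
  of \<open>contract\<close> at index 0 encodes the projection to positive frequencies.\<close>

lemma has_coeffs_Gam:
  assumes w: "has_coeffs f (nat_coeffs w)"
    and p: "has_coeffs g (nat_coeffs p)" "p 0 = 0" "\<And>m. m > N \<Longrightarrow> p m = 0"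
  shows "has_coeffs (Gam f g) (nat_coeffs (contract N p w))"
proof -
  have "(\<Sum>j | nat_coeffs p (- j) \<noteq> 0. nat_coeffs p (- j) * nat_coeffs w (k - j))
      = nat_coeffs (contract N p w) k" if "k \<ge> 1" for k
  proof -
    have "(\<Sum>j | nat_coeffs p (- j) \<noteq> 0. nat_coeffs p (- j) * nat_coeffs w (k - j))
        = (\<Sum>j | nat_coeffs p j \<noteq> 0. nat_coeffs p j * nat_coeffs w (k + j))"
      by (rule sum.reindex_bij_witness[of _ uminus uminus]) auto
    also have "\<dots> = (\<Sum>n=1..N. of_real (p n) * nat_coeffs w (k + int n))"
      by (rule sum_nat_coeffs[of p N, OF p(2,3)])
    also have "\<dots> = nat_coeffs (contract N p w) k"
      using that by (simp add: nat_coeffs_def contract_def nat_add_distrib)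
    finally show ?thesis .
  qed
  hence "(\<lambda>k. if k \<ge> 1 then \<Sum>j | nat_coeffs p (- j) \<noteq> 0. nat_coeffs p (- j) * nat_coeffs w (k - j)
        else 0) = nat_coeffs (contract N p w)"
    by (auto simp: nat_coeffs_def contract_def)
  moreover have "(\<lambda>y. f y * reflect g y) = (\<lambda>y. reflect g y * f y)"
    by (simp add: mult.commute)
  ultimately show ?thesis
    using has_coeffs_proj_plus0[OF has_coeffs_mult[OF has_coeffs_reflect[OF p(1)] w]]
    by (simp add: Gam_def)
qed

text \<open>This is the coefficient of u Pi^+(L^(k+1) v) at frequency \<open>n\<close>: the
  projection cuts the convolution at \<open>j \<le> n\<close>, and \<open>u 0 = 0\<close> starts it
  at 1.\<close>

lemma sum_proj_plus_shift:
  fixes n k K :: nat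
  assumes "u 0 = 0" "\<And>m. m > K \<Longrightarrow> u m = 0"
  shows "(\<Sum>j | nat_coeffs u j \<noteq> 0. nat_coeffs u j *
      (if 0 \<le> int n - j then nat_coeffs v (int n - j + int (k + 1)) else 0))
    = of_real (\<Sum>i=1..n. u i * v (n + k + 1 - i))"
proof -
  have eq: "nat (int n - int i + int (Suc k)) = Suc (n + k) - i" if "i \<le> n" for i
    using that by simp
  have "(\<Sum>j | nat_coeffs u j \<noteq> 0. nat_coeffs u j *
      (if 0 \<le> int n - j then nat_coeffs v (int n - j + int (k + 1)) else 0))
    = (\<Sum>i=1..K. of_real (u i) *
      (if 0 \<le> int n - int i then nat_coeffs v (int n - int i + int (k + 1)) else 0))"
    by (rule sum_nat_coeffs[of u K, OF assms])
  also have "\<dots> = (\<Sum>i=1..n. of_real (u i) * of_real (v (n + k + 1 - i)))"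
    using assms(2)
    by (intro sum.mono_neutral_cong) (auto simp: nat_coeffs_def eq simp del: of_nat_Suc of_nat_add)
  finally show ?thesis by simp
qed

lemma Ham_has_coeffs:
  assumes w: "has_coeffs f (nat_coeffs w)" "w 0 = 0" "\<And>m. m > N + 1 \<Longrightarrow> w m = 0"
    and p: "has_coeffs g (nat_coeffs p)" "p 0 = 0" "\<And>m. m > N \<Longrightarrow> p m = 0"
  shows "Ham (f, g) = of_real (\<Sum>a=1..N. p a * contract N p w a)"
proof -
  have "Ham (f, g) = (\<Sum>k=1..N + 1. of_real (w k) *
      (\<Sum>a=1..N. of_real (p a) * nat_coeffs p (int k - int a)))"
    using sum_nat_coeffs[of w "N + 1"] w(2,3)
    by (simp only: Ham_def prod.case pairing_has_coeffs[OF w(1) has_coeffs_square[OF p]])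
  also have "\<dots> = of_real (\<Sum>a=1..N. p a * (\<Sum>k=1..N + 1. w k * p (k - a)))"
    unfolding sum_distrib_left of_real_sum
    by (subst sum.swap)
       (simp add: nat_coeffs_def nat_diff_distrib' mult_ac del: sum.cl_ivl_Suc)
  also have "(\<Sum>a=1..N. p a * (\<Sum>k=1..N + 1. w k * p (k - a)))
      = (\<Sum>a=1..N. p a * contract N p w a)"
  proof (rule sum.cong[OF refl])
    fix a assume "a \<in> {1..N}"
    thus "p a * (\<Sum>k=1..N + 1. w k * p (k - a)) = p a * contract N p w a"
      using sum_truncated_shift[of p N "N + 1" w a] w p by (simp add: contract_def mult.commute)
  qed
  finally show ?thesis .
qed

lemma Iint_has_coeffs:
  assumes w: "has_coeffs f (nat_coeffs w)" "w 0 = 0" "\<And>m. m > N + 1 \<Longrightarrow> w m = 0"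
    and p: "has_coeffs g (nat_coeffs p)" "p 0 = 0" "\<And>m. m > N \<Longrightarrow> p m = 0"
  shows "Iint k (f, g) = of_real (integral_fn N w p k)"
proof -
  let ?h = "contract N p w"
  have h: "has_coeffs (Gam f g) (nat_coeffs ?h)" "?h 0 = 0" "\<And>m. m > N + 1 \<Longrightarrow> ?h m = 0"
    using has_coeffs_Gam[OF w(1) p] contract_vanish[of N w] w(3) by (auto simp: contract_def)
  define c where "c = (\<lambda>n. (\<Sum>j | nat_coeffs ?h j \<noteq> 0. nat_coeffs ?h j *
         (if 0 \<le> n - j then nat_coeffs w (n - j + int (k + 1)) else 0)) -
       (\<Sum>j | nat_coeffs w j \<noteq> 0. nat_coeffs w j *
         (if 0 \<le> n - j then nat_coeffs ?h (n - j + int (k + 1)) else 0)))"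
  have A: "has_coeffs (Aop k f (Gam f g)) c"
    unfolding Aop_def[abs_def] c_def
    by (intro has_coeffs_diff has_coeffs_mult h(1) w(1)
        has_coeffs_proj_plus[OF has_coeffs_shiftL_funpow])
  \<comment> \<open>\<open>sum_proj_plus_shift\<close> yields sums up to the frequency
    \<open>n\<close>, whereas \<open>bezout\<close> sums up to \<open>k\<close>; symmetry exchanges
    the two.\<close>
  have c: "c (int n) = of_real (bezout w ?h k n)" for n
    by (subst bezout_sym, simp only: c_def sum_proj_plus_shift[of ?h "N + 1", OF h(2,3)]
        sum_proj_plus_shift[of w "N + 1", OF w(2,3)])
      (simp add: bezout_def sum_subtractf add_ac)
  \<comment> \<open>With \<open>g\<close> in first place the pairing becomes a sum over the range
    \<open>1..N\<close> that supports \<open>p\<close>.\<close>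
  have "Iint k (f, g) = pairing g (Aop k f (Gam f g))"
    by (simp add: Iint_def pairing_def mult.commute)
  also have "\<dots> = (\<Sum>n=1..N. of_real (p n) * c (int n))"
    by (simp only: pairing_has_coeffs[OF p(1) A] sum_nat_coeffs[of p N, OF p(2,3)])
  also have "\<dots> = of_real (integral_fn N w p k)"
    by (simp add: integral_fn_def c)
  finally show ?thesis .
qed

subsection \<open>Points of \<open>PF\<^sub>N\<close>\<close>

definition p_ext :: "nat \<Rightarrow> real vec \<Rightarrow> nat \<Rightarrow> real" where
  "p_ext N p l = (if 1 \<le> l \<and> l \<le> N then p $ (l - 1) else 0)"

lemma w_ext_simps [simp]:
  "w_ext N w 0 = 0" "w_ext N w (N + 1) = 1" "w_ext N w (Suc N) = 1"
  "m > N + 1 \<Longrightarrow> w_ext N w m = 0"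
  by (auto simp: w_ext_def)

lemma p_ext_simps [simp]: "p_ext N p 0 = 0" "m > N \<Longrightarrow> p_ext N p m = 0"
  by (auto simp: p_ext_def)

lemma ident_has_coeffs:
  assumes "(w, p) \<in> cotangent N"
  shows "has_coeffs (fst (ident N (w, p))) (nat_coeffs (w_ext N w))"
    and "has_coeffs (snd (ident N (w, p))) (nat_coeffs (p_ext N p))"
proof -
  have d: "dim_vec w = N" "dim_vec p = N" using assms by (auto simp: cotangent_def)
  have "(\<Sum>k=1..N + 1. of_real (w_ext N w k) * echar (int k) y) =
      (\<Sum>k=1..N. of_real (w_ext N w k) * echar (int k) y) + echar (int (N + 1)) y" for y
    by simp
  hence 1: "fst (ident N (w, p)) = (\<lambda>y. \<Sum>k=1..N + 1. of_real (w_ext N w k) * echar (int k) y)"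
    by (auto simp: ident_def PF_point_def w_ext_def d simp del: sum.cl_ivl_Suc of_nat_Suc of_nat_add
        intro!: ext sum.cong)
  have 2: "snd (ident N (w, p)) = (\<lambda>y. \<Sum>k=1..N. of_real (p_ext N p k) * echar (int k) y)"
    by (auto simp: ident_def PF_point_def p_ext_def d intro!: ext sum.cong)
  show "has_coeffs (fst (ident N (w, p))) (nat_coeffs (w_ext N w))"
    unfolding 1 by (rule has_coeffs_nat_coeffs) auto
  show "has_coeffs (snd (ident N (w, p))) (nat_coeffs (p_ext N p))"
    unfolding 2 by (rule has_coeffs_nat_coeffs) auto
qed

text \<open>This is the quadratic form of the Hankel matrix, taken on sequences so that one
  derivative formula serves both positions and momenta.\<close>

definition ham_fn :: "nat \<Rightarrow> (nat \<Rightarrow> real) \<Rightarrow> (nat \<Rightarrow> real) \<Rightarrow> real" where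
  "ham_fn N w p = (\<Sum>a=1..N. p a * contract N p w a)"

lemma Ham_ident:
  assumes "(w, p) \<in> cotangent N"
  shows "Ham (ident N (w, p)) = of_real (ham_fn N (w_ext N w) (p_ext N p))"
  using Ham_has_coeffs[OF ident_has_coeffs(1)[OF assms] _ _ ident_has_coeffs(2)[OF assms]]
  by (simp add: ham_fn_def)

lemma Iint_ident:
  assumes "(w, p) \<in> cotangent N"
  shows "Iint k (ident N (w, p)) = of_real (integral_fn N (w_ext N w) (p_ext N p) k)"
  using Iint_has_coeffs[OF ident_has_coeffs(1)[OF assms] _ _ ident_has_coeffs(2)[OF assms]]
  by simp

section \<open>The Hankel matrix and the inverse metric\<close>

lemma hankel_mult_index:
  assumes "p \<in> carrier_vec N" "i < N"
  shows "(hankel N w *\<^sub>v p) $ i = contract N (p_ext N p) (w_ext N w) (i + 1)"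
proof -
  have "(hankel N w *\<^sub>v p) $ i = (\<Sum>j<N. w_ext N w (i + 1 + (j + 1)) * p $ j)"
    using assms by (simp add: hankel_def scalar_prod_def row_def atLeast0LessThan)
  also have "\<dots> = (\<Sum>n=1..N. w_ext N w (i + 1 + n) * p_ext N p n)"
    by (rule sum.reindex_bij_witness[of _ "\<lambda>n. n - 1" Suc]) (auto simp: p_ext_def)
  finally show ?thesis by (simp add: contract_def mult.commute)
qed

lemma sum_p_ext:
  "(\<Sum>i<N. p $ i * F (i + 1)) = (\<Sum>n=1..N. p_ext N p n * F n)"
  by (rule sum.reindex_bij_witness[of _ "\<lambda>n. n - 1" Suc]) (auto simp: p_ext_def)

lemma ham_fn_hankel:
  assumes "p \<in> carrier_vec N"
  shows "(\<Sum>j<N. \<Sum>k<N. hankel N w $$ (j, k) * p $ j * p $ k) = ham_fn N (w_ext N w) (p_ext N p)"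
proof -
  have "(\<Sum>k<N. hankel N w $$ (j, k) * p $ j * p $ k)
      = p $ j * contract N (p_ext N p) (w_ext N w) (j + 1)" if "j < N" for j
    using assms that hankel_mult_index[OF assms that, of w, symmetric]
    by (simp add: hankel_def scalar_prod_def row_def sum_distrib_left atLeast0LessThan mult_ac)
  thus ?thesis using sum_p_ext[of p "contract N (p_ext N p) (w_ext N w)" N]
    by (simp add: ham_fn_def)
qed

text \<open>Invertibility ensures that \<open>mat_inverse\<close> returns a matrix, and inverses are
  unique.\<close>

lemma mat_inverse_metric_tensor: "the (mat_inverse (metric_tensor N w)) = hankel N w"
proof -
  have M: "metric_tensor N w \<in> carrier_mat N N"
    and inv: "hankel N w * metric_tensor N w = 1\<^sub>m N" "metric_tensor N w * hankel N w = 1\<^sub>m N"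
    by (rule metric_tensor_inverse)+
  have H: "hankel N w \<in> carrier_mat N N" by (simp add: hankel_def)
  have "metric_tensor N w \<in> Units (ring_mat TYPE(real) N ())"
    using M H inv by (auto simp: Units_def ring_mat_def)
  then obtain B where B: "mat_inverse (metric_tensor N w) = Some B"
    using mat_inverse(1)[OF M, of "()"] by (cases "mat_inverse (metric_tensor N w)") auto
  from mat_inverse(2)[OF M B] have B': "metric_tensor N w * B = 1\<^sub>m N" "B \<in> carrier_mat N N"
    by auto
  have "B = (hankel N w * metric_tensor N w) * B" using inv B' by simp
  also have "\<dots> = hankel N w * (metric_tensor N w * B)"
    by (rule assoc_mult_mat[OF H M B'(2)])
  also have "\<dots> = hankel N w" using B' H by simp
  finally show ?thesis using B by simp
qed

lemma cometric_ham_fn: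
  assumes "(w, p) \<in> cotangent N"
  shows "cometric N (w, p) = ham_fn N (w_ext N w) (p_ext N p)"
proof -
  have p: "p \<in> carrier_vec N" using assms by (simp add: cotangent_def)
  have "cometric N (w, p) = (\<Sum>i<N. (hankel N w *\<^sub>v p) $ i * p $ i)"
    using p by (simp add: cometric_def mat_inverse_metric_tensor scalar_prod_def atLeast0LessThan)
  also have "\<dots> = (\<Sum>i<N. p $ i * contract N (p_ext N p) (w_ext N w) (i + 1))"
    using hankel_mult_index[OF p] by (intro sum.cong) auto
  also have "\<dots> = ham_fn N (w_ext N w) (p_ext N p)"
    unfolding sum_p_ext by (simp add: ham_fn_def)
  finally show ?thesis .
qed

subsection \<open>The flow\<close>

lemma has_real_derivative_contract:
  assumes "\<And>n. ((\<lambda>s. p s n) has_real_derivative p' n) (at t within S)"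
    and "\<And>n. n \<ge> 1 \<Longrightarrow> ((\<lambda>s. u s n) has_real_derivative u' n) (at t within S)"
  shows "((\<lambda>s. contract N (p s) (u s) j) has_real_derivative
    contract N p' (u t) j + contract N (p t) u' j) (at t within S)"
proof (cases "j = 0")
  case False
  have "((\<lambda>s. \<Sum>n=1..N. p s n * u s (j + n)) has_real_derivative
      (\<Sum>n=1..N. p' n * u t (j + n) + p t n * u' (j + n))) (at t within S)"
    by (rule DERIV_sum) (use assms False in \<open>auto intro!: derivative_eq_intros\<close>)
  with False show ?thesis by (simp add: contract_def sum.distrib)
qed (simp add: contract_def)

text \<open>The form is linear in \<open>w\<close> and quadratic in \<open>p\<close> with symmetric
  coefficients \<open>w (a + b)\<close>, whence the factor 2.\<close>

lemma has_real_derivative_ham_fn: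
  assumes "\<And>n. ((\<lambda>s. p s n) has_real_derivative p' n) (at t within S)"
    and "\<And>n. n \<ge> 1 \<Longrightarrow> ((\<lambda>s. w s n) has_real_derivative w' n) (at t within S)"
  shows "((\<lambda>s. ham_fn N (w s) (p s)) has_real_derivative
    2 * (\<Sum>a=1..N. p' a * contract N (p t) (w t) a) + ham_fn N w' (p t)) (at t within S)"
proof -
  have swap: "(\<Sum>a=1..N. p t a * contract N p' (w t) a) = (\<Sum>a=1..N. p' a * contract N (p t) (w t) a)"
  proof -
    have "(\<Sum>a=1..N. p t a * contract N p' (w t) a)
        = (\<Sum>a=1..N. \<Sum>b=1..N. p t a * p' b * w t (a + b))"
      by (simp add: contract_def sum_distrib_left mult.assoc)
    also have "\<dots> = (\<Sum>b=1..N. \<Sum>a=1..N. p t a * p' b * w t (a + b))"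
      by (rule sum.swap)
    also have "\<dots> = (\<Sum>a=1..N. p' a * contract N (p t) (w t) a)"
      by (simp add: contract_def sum_distrib_left mult_ac add.commute)
    finally show ?thesis .
  qed
  have "((\<lambda>s. ham_fn N (w s) (p s)) has_real_derivative
      (\<Sum>a=1..N. p' a * contract N (p t) (w t) a
        + p t a * (contract N p' (w t) a + contract N (p t) w' a))) (at t within S)"
    unfolding ham_fn_def
    by (intro DERIV_sum DERIV_cong[OF DERIV_mult[OF assms(1) has_real_derivative_contract[OF assms]]])
       auto
  thus ?thesis unfolding sum.distrib distrib_left swap ham_fn_def[of N w'] by (simp add: add.assoc)
qed

lemma d_mom_ham_fn:
  assumes x: "(w, p) \<in> cotangent N" and l: "l < N"
    and F: "\<And>w p. (w, p) \<in> cotangent N \<Longrightarrow> F (w, p) = ham_fn N (w_ext N w) (p_ext N p)"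
  shows "d_mom N l F (w, p) = 2 * contract N (p_ext N p) (w_ext N w) (l + 1)"
proof -
  have d: "dim_vec w = N" "dim_vec p = N" using x by (auto simp: cotangent_def)
  define \<delta> where "\<delta> = (\<lambda>n. if n = l + 1 then 1 else 0 :: real)"
  have p: "p_ext N (p + s \<cdot>\<^sub>v unit_vec N l) = (\<lambda>n. p_ext N p n + s * \<delta> n)" for s
    using d l by (auto simp: p_ext_def \<delta>_def unit_vec_def fun_eq_iff)
  have "F (w, p + s \<cdot>\<^sub>v unit_vec N l) = ham_fn N (w_ext N w) (\<lambda>n. p_ext N p n + s * \<delta> n)" for s
    using x by (subst F) (auto simp: cotangent_def p)
  hence "d_mom N l F (w, p) = deriv (\<lambda>s. ham_fn N (w_ext N w) (\<lambda>n. p_ext N p n + s * \<delta> n)) 0"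
    by (simp add: d_mom_def)
  also have "\<dots> = 2 * (\<Sum>a=1..N. \<delta> a * contract N (\<lambda>n. p_ext N p n + 0 * \<delta> n) (w_ext N w) a)
      + ham_fn N (\<lambda>_. 0) (\<lambda>n. p_ext N p n + 0 * \<delta> n)"
    by (rule DERIV_imp_deriv, rule has_real_derivative_ham_fn) (auto intro!: derivative_eq_intros)
  also have "ham_fn N (\<lambda>_. 0) q = 0" for q by (simp add: ham_fn_def contract_def)
  finally show ?thesis using l by (simp add: \<delta>_def if_distrib[of "\<lambda>x. x * _"] cong: if_cong)
qed

text \<open>The Hamiltonian is linear in \<open>w\<close>, and position \<open>l\<close> is
  multiplied by the coefficient of \<open>p\<^sup>2\<close> at frequency
  \<open>l + 1\<close>.\<close>

lemma d_pos_ham_fn: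
  assumes x: "(w, p) \<in> cotangent N" and l: "l < N"
    and F: "\<And>w p. (w, p) \<in> cotangent N \<Longrightarrow> F (w, p) = ham_fn N (w_ext N w) (p_ext N p)"
  shows "d_pos N l F (w, p) = (\<Sum>a=1..N. p_ext N p a * p_ext N p (l + 1 - a))"
proof -
  have d: "dim_vec w = N" "dim_vec p = N" using x by (auto simp: cotangent_def)
  define \<delta> where "\<delta> = (\<lambda>n. if n = l + 1 then 1 else 0 :: real)"
  have w: "w_ext N (w + s \<cdot>\<^sub>v unit_vec N l) = (\<lambda>n. w_ext N w n + s * \<delta> n)" for s
    using d l by (auto simp: w_ext_def \<delta>_def unit_vec_def fun_eq_iff)
  have "F (w + s \<cdot>\<^sub>v unit_vec N l, p) = ham_fn N (\<lambda>n. w_ext N w n + s * \<delta> n) (p_ext N p)" for s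
    using x by (subst F) (auto simp: cotangent_def w)
  hence "d_pos N l F (w, p) = deriv (\<lambda>s. ham_fn N (\<lambda>n. w_ext N w n + s * \<delta> n) (p_ext N p)) 0"
    by (simp add: d_pos_def)
  also have "\<dots> = 2 * (\<Sum>a=1..N. 0 * contract N (p_ext N p) (\<lambda>n. w_ext N w n + 0 * \<delta> n) a)
      + ham_fn N \<delta> (p_ext N p)"
    by (rule DERIV_imp_deriv, rule has_real_derivative_ham_fn) (auto intro!: derivative_eq_intros)
  also have "\<dots> = (\<Sum>a=1..N. p_ext N p a * contract N (p_ext N p) \<delta> a)"
    by (simp add: ham_fn_def)
  also have "\<dots> = (\<Sum>a=1..N. p_ext N p a * p_ext N p (l + 1 - a))"
  proof (rule sum.cong[OF refl])
    fix a assume a: "a \<in> {1..N}"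
    have "contract N (p_ext N p) \<delta> a = (\<Sum>n=1..N. p_ext N p n * \<delta> (a + n))"
      using a by (simp add: contract_def)
    \<comment> \<open>As \<open>n \<ge> 1\<close>, the conditions \<open>a + n = l + 1\<close> and
      \<open>n = l + 1 - a\<close> agree even where the subtraction truncates to 0.\<close>
    also have "\<dots> = (\<Sum>n=1..N. if n = l + 1 - a then p_ext N p n else 0)"
      by (rule sum.cong) (auto simp: \<delta>_def)
    also have "\<dots> = p_ext N p (l + 1 - a)"
      by (auto simp: p_ext_def)
    finally show "p_ext N p a * contract N (p_ext N p) \<delta> a = p_ext N p a * p_ext N p (l + 1 - a)"
      by simp
  qed
  finally show ?thesis .
qed

section \<open>Hamilton's equations and conservation of the integrals\<close>

lemma poisson_coordinates:
  assumes "x \<in> cotangent N" "i < N"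
  shows "poisson N F (\<lambda>z. fst z $ i) x = d_mom N i F x"
    and "poisson N F (\<lambda>z. snd z $ i) x = - d_pos N i F x"
proof -
  obtain w p where x: "x = (w, p)" "dim_vec w = N" "dim_vec p = N"
    using assms(1) by (auto simp: cotangent_def)
  have d: "d_pos N l (\<lambda>z. fst z $ i) x = (if l = i then 1 else 0)"
     "d_mom N l (\<lambda>z. snd z $ i) x = (if l = i then 1 else 0)"
     "d_pos N l (\<lambda>z. snd z $ i) x = 0" "d_mom N l (\<lambda>z. fst z $ i) x = 0"
     if "l < N" for l
    using that assms(2) x deriv_affine by (auto simp: d_pos_def d_mom_def unit_vec_def)
  show "poisson N F (\<lambda>z. fst z $ i) x = d_mom N i F x"
    "poisson N F (\<lambda>z. snd z $ i) x = - d_pos N i F x"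
    using assms(2)
    by (simp_all add: poisson_def d sum_negf if_distrib[of "\<lambda>y. _ * y"] cong: if_cong)
qed

text \<open>The partial derivatives move along coordinate lines, which stay inside
  \<open>cotangent N\<close>.\<close>

lemma hamiltonian_flow_cong:
  assumes F: "\<And>x. x \<in> cotangent N \<Longrightarrow> F x = F' x"
  shows "hamiltonian_flow N F = hamiltonian_flow N F'"
proof -
  have d: "d_pos N i F x = d_pos N i F' x" "d_mom N i F x = d_mom N i F' x"
    if "x \<in> cotangent N" for i x
    using that by (auto simp: d_pos_def d_mom_def cotangent_def F)
  hence "poisson N F G x = poisson N F' G x" if "x \<in> cotangent N" for G x
    using that by (simp add: poisson_def)
  thus ?thesis unfolding hamiltonian_flow_def by (simp cong: conj_cong)
qed

text \<open>Since p' is minus the coefficients of \<open>p\<^sup>2\<close>, contraction with p' is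
  minus a double contraction with p. This gives g' = -h + 2 h = h and makes the two terms of h'
  cancel.\<close>

lemma first_integral_fn:
  assumes F: "\<And>w p. (w, p) \<in> cotangent N \<Longrightarrow> F (w, p) = ham_fn N (w_ext N w) (p_ext N p)"
    and G: "\<And>w p. (w, p) \<in> cotangent N \<Longrightarrow> G (w, p) = integral_fn N (w_ext N w) (p_ext N p) k"
  shows "first_integral (hamiltonian_flow N F) G"
proof -
  have "G y = G x" if flow: "(t, x, y) \<in> hamiltonian_flow N F" for t x y
  proof -
    from flow obtain J \<gamma> where "open J \<and> is_interval J \<and> 0 \<in> J \<and> t \<in> J \<and> \<gamma> 0 = x \<and> \<gamma> t = y \<and>
       (\<forall>s\<in>J. \<gamma> s \<in> cotangent N \<and> (\<forall>i<N.
           ((\<lambda>s. fst (\<gamma> s) $ i) has_real_derivative poisson N F (\<lambda>z. fst z $ i) (\<gamma> s)) (at s) \<and>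
           ((\<lambda>s. snd (\<gamma> s) $ i) has_real_derivative poisson N F (\<lambda>z. snd z $ i) (\<gamma> s)) (at s)))"
      unfolding hamiltonian_flow_def mem_Collect_eq prod.case by (elim exE) rule
    hence J: "is_interval J" "0 \<in> J" "t \<in> J" "\<gamma> 0 = x" "\<gamma> t = y"
      and \<gamma>: "\<And>s. s \<in> J \<Longrightarrow> \<gamma> s \<in> cotangent N"
      and dw: "\<And>s i. s \<in> J \<Longrightarrow> i < N \<Longrightarrow>
         ((\<lambda>s. fst (\<gamma> s) $ i) has_real_derivative poisson N F (\<lambda>z. fst z $ i) (\<gamma> s)) (at s)"
      and dp: "\<And>s i. s \<in> J \<Longrightarrow> i < N \<Longrightarrow>
         ((\<lambda>s. snd (\<gamma> s) $ i) has_real_derivative poisson N F (\<lambda>z. snd z $ i) (\<gamma> s)) (at s)"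
      by simp_all
    define w where "w = (\<lambda>s. w_ext N (fst (\<gamma> s)))"
    define p where "p = (\<lambda>s. p_ext N (snd (\<gamma> s)))"
    define g where "g = (\<lambda>s. contract N (p s) (w s))"
    define h where "h = (\<lambda>s. contract N (p s) (g s))"
    have g_eq: "g s = contract N (p s) (w s)" and h_eq: "h s = contract N (p s) (g s)" for s
      by (simp_all add: g_def h_def)
    have \<gamma>': "(fst (\<gamma> s), snd (\<gamma> s)) \<in> cotangent N" if "s \<in> J" for s using \<gamma>[OF that] by simp
    have wz: "\<And>s m. m > N + 1 \<Longrightarrow> w s m = 0" and pz: "\<And>s. p s 0 = 0" "\<And>s m. m > N \<Longrightarrow> p s m = 0"
      by (auto simp: w_def p_def)
    have gz: "g s m = 0" if "m > N" for s m
      unfolding g_def by (rule contract_vanish[OF _ that]) (rule wz)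
    have w': "((\<lambda>s. w s n) has_real_derivative 2 * g s n) (at s)" if s: "s \<in> J" and n: "n \<ge> 1" for s n
    proof (cases "n \<le> N")
      case True
      hence "poisson N F (\<lambda>z. fst z $ (n - 1)) (\<gamma> s) = 2 * g s n"
        using n poisson_coordinates(1)[OF \<gamma>[OF s], of "n - 1" F]
          d_mom_ham_fn[OF \<gamma>'[OF s], of "n - 1" F, OF _ F] by (simp add: g_def w_def p_def)
      with dw[OF s, of "n - 1"] True n show ?thesis by (simp add: w_def w_ext_def)
    next
      case False
      \<comment> \<open>Beyond \<open>N\<close> the sequence \<open>w\<close> is constant in time,
        equal to 1 at \<open>N + 1\<close> and 0 afterwards, while \<open>g\<close>
        vanishes.\<close>
      thus ?thesis using gz[of n s] by (simp add: w_def w_ext_def)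
    qed
    \<comment> \<open>Beyond \<open>N\<close> the sequence \<open>p\<close> stays zero although its
      square need not; at \<open>n = 0\<close> every product contains
      \<open>p s 0 = 0\<close>.\<close>
    have p': "((\<lambda>s. p s n) has_real_derivative
        (if n \<le> N then - (\<Sum>a=1..N. p s a * p s (n - a)) else 0)) (at s)" if s: "s \<in> J" for s n
    proof (cases "1 \<le> n \<and> n \<le> N")
      case True
      hence n: "n - 1 < N" by auto
      have "poisson N F (\<lambda>z. snd z $ (n - 1)) (\<gamma> s) = - (\<Sum>a=1..N. p s a * p s (n - a))"
        using True poisson_coordinates(2)[OF \<gamma>[OF s] n, of F]
          d_pos_ham_fn[OF \<gamma>'[OF s] n, of F, OF F] by (simp add: p_def)
      with dp[OF s n] True show ?thesis by (simp add: p_def p_ext_def)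
    next
      case False
      thus ?thesis by (auto simp: p_def p_ext_def)
    qed
    \<comment> \<open>\<open>contract\<close> reads its multiplier only on \<open>1..N\<close>, so
      the cutoff disappears and \<open>contract_convolution\<close> applies.\<close>
    have convolve: "contract N (\<lambda>n. if n \<le> N then - (\<Sum>a=1..N. p s a * p s (n - a)) else 0) u j
        = - contract N (p s) (contract N (p s) u) j" if "\<And>m. m > N + 1 \<Longrightarrow> u m = 0" for s u j
    proof -
      have "contract N (\<lambda>n. if n \<le> N then - q n else 0) u j = - contract N q u j" for q
        by (auto simp: contract_def sum_negf[symmetric] intro!: sum.cong)
      thus ?thesis using contract_convolution[of "p s" N u j] pz that by simp
    qed
    have double: "contract N q (\<lambda>n. 2 * u n) j = 2 * contract N q u j" for q u j
      by (simp add: contract_def sum_distrib_left mult_ac)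
    have g': "((\<lambda>s. g s n) has_real_derivative h s n) (at s)" if s: "s \<in> J" for s n
    proof -
      have "((\<lambda>s. contract N (p s) (w s) n) has_real_derivative
          contract N (\<lambda>n. if n \<le> N then - (\<Sum>a=1..N. p s a * p s (n - a)) else 0) (w s) n
          + contract N (p s) (\<lambda>n. 2 * g s n) n) (at s)"
        by (rule has_real_derivative_contract[OF p'[OF s] w'[OF s]])
      thus ?thesis using wz by (simp add: convolve double g_eq[symmetric] h_eq[symmetric])
    qed
    have h': "((\<lambda>s. h s n) has_real_derivative 0) (at s)" if s: "s \<in> J" for s n
    proof -
      have "((\<lambda>s. contract N (p s) (g s) n) has_real_derivative
          contract N (\<lambda>n. if n \<le> N then - (\<Sum>a=1..N. p s a * p s (n - a)) else 0) (g s) n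
          + contract N (p s) (h s) n) (at s)"
        by (rule has_real_derivative_contract[OF p'[OF s] g'[OF s]])
      thus ?thesis using gz by (simp add: convolve h_eq[symmetric])
    qed
    have "((\<lambda>s. integral_fn N (w s) (p s) k) has_real_derivative 0) (at s)" if s: "s \<in> J" for s
    proof -
      have "((\<lambda>s. \<Sum>i=1..k. g s i * g s (k + 1 - i) - w s i * h s (k + 1 - i)) has_real_derivative
          (\<Sum>i=1..k. (h s i * g s (k + 1 - i) + g s i * h s (k + 1 - i))
            - (2 * g s i * h s (k + 1 - i) + w s i * 0))) (at s)"
      proof (rule DERIV_sum)
        fix i assume "i \<in> {1..k}"
        hence "i \<ge> 1" by simp
        note DERIV_diff[OF DERIV_mult[OF g'[OF s] g'[OF s]] DERIV_mult[OF w'[OF s this] h'[OF s]],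
            of i "k + 1 - i" "k + 1 - i"]
        thus "((\<lambda>s. g s i * g s (k + 1 - i) - w s i * h s (k + 1 - i)) has_real_derivative
            (h s i * g s (k + 1 - i) + g s i * h s (k + 1 - i))
            - (2 * g s i * h s (k + 1 - i) + w s i * 0)) (at s)"
          by (simp add: mult.commute)
      qed
      also have "(\<Sum>i=1..k. (h s i * g s (k + 1 - i) + g s i * h s (k + 1 - i))
            - (2 * g s i * h s (k + 1 - i) + w s i * 0))
          = (\<Sum>i=1..k. h s i * g s (k + 1 - i)) - (\<Sum>i=1..k. g s i * h s (k + 1 - i))"
        by (simp add: sum_subtractf sum.distrib sum_distrib_left[symmetric] mult.assoc)
      \<comment> \<open>The reflection \<open>i \<mapsto> k + 1 - i\<close> identifies the two sums,
        so the derivative vanishes.\<close>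
      also have "(\<Sum>i=1..k. h s i * g s (k + 1 - i)) = (\<Sum>i=1..k. g s i * h s (k + 1 - i))"
        by (rule sum.reindex_bij_witness[of _ "\<lambda>i. k + 1 - i" "\<lambda>i. k + 1 - i"]) auto
      finally show ?thesis
        by (simp add: integral_fn_closed_form g_eq h_eq)
    qed
    hence "\<exists>c. \<forall>s\<in>J. integral_fn N (w s) (p s) k = c"
      using J(1) by (intro has_field_derivative_zero_constant)
        (auto simp: is_interval_convex_1 intro: has_field_derivative_at_within)
    with J have "integral_fn N (w t) (p t) k = integral_fn N (w 0) (p 0) k" by metis
    thus "G y = G x"
      using J G[OF \<gamma>'[OF J(2)]] G[OF \<gamma>'[OF J(3)]] by (simp add: w_def p_def)
  qed
  thus ?thesis by (auto simp: first_integral_def)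
qed

subsection \<open>The generating function\<close>

lemma continuous_on_det:
  fixes A :: "'a :: topological_space \<Rightarrow> 'b :: {comm_ring_1, real_normed_algebra_1} mat"
  assumes "\<And>x. A x \<in> carrier_mat n n"
    and "\<And>i j. i < n \<Longrightarrow> j < n \<Longrightarrow> continuous_on S (\<lambda>x. A x $$ (i, j))"
  shows "continuous_on S (\<lambda>x. det (A x))"
proof -
  have "\<sigma> i < n" if "\<sigma> permutes {0..<n}" "i < n" for \<sigma> i
    using permutes_in_image[OF that(1), of i] that(2) by simp
  thus ?thesis
    unfolding det_def'[OF assms(1)] by (intro continuous_intros) (auto intro: assms(2))
qed

text \<open>The entries of the adjugate are cofactors; their continuity carries the identity to
  values of mu where mu Id + M_N(w) is singular.\<close>

lemma continuous_on_cofactor: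
  fixes A :: "'a :: topological_space \<Rightarrow> 'b :: {comm_ring_1, real_normed_algebra_1} mat"
  assumes "\<And>x. A x \<in> carrier_mat n n"
    and "\<And>i j. i < n \<Longrightarrow> j < n \<Longrightarrow> continuous_on S (\<lambda>x. A x $$ (i, j))"
  shows "continuous_on S (\<lambda>x. cofactor (A x) i j)"
  unfolding cofactor_def
proof (intro continuous_intros continuous_on_det)
  show "mat_delete (A x) i j \<in> carrier_mat (n - 1) (n - 1)" for x
    using mat_delete_carrier[OF assms(1)] .
  show "continuous_on S (\<lambda>x. mat_delete (A x) i j $$ (k, l))" if "k < n - 1" "l < n - 1" for k l
    using that by (auto simp: mat_delete_def carrier_matD[OF assms(1)] intro!: assms(2))
qed

text \<open>In the first row only the first and last entries can be nonzero. One minor is the same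
  matrix with \<open>v\<close> shifted, so the induction varies \<open>v\<close>; the other is upper
  triangular with diagonal -1, and its sign cancels the cofactor sign.\<close>

lemma det_companion:
  fixes v :: "nat \<Rightarrow> 'a :: comm_ring_1"
  assumes "n \<ge> 1"
  shows "det (mat n n (\<lambda>(i, j). (if i = j then x else 0) +
      (if j = n - 1 then v i else if i = j + 1 then - 1 else 0))) = x ^ n + (\<Sum>i<n. v i * x ^ i)"
  using assms
proof (induction n arbitrary: v rule: nat_induct_at_least)
  case base
  show ?case by (subst det_single) auto
next
  case (Suc n)
  define A where "A = mat (Suc n) (Suc n) (\<lambda>(i, j). (if i = j then x else 0) +
      (if j = n then v i else if i = j + 1 then - 1 else 0))"
  have A: "A \<in> carrier_mat (Suc n) (Suc n)" by (simp add: A_def)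
  have "mat_delete A 0 0 = mat n n (\<lambda>(i, j). (if i = j then x else 0) +
      (if j = n - 1 then v (Suc i) else if i = j + 1 then - 1 else 0))"
    using Suc.hyps by (intro eq_matI) (auto simp: mat_delete_def A_def)
  hence c0: "cofactor A 0 0 = x ^ n + (\<Sum>i<n. v (Suc i) * x ^ i)"
    using Suc.IH[of "\<lambda>i. v (Suc i)"] by (simp add: cofactor_def)
  define D where "D = mat_delete A 0 n"
  have D: "D \<in> carrier_mat n n" unfolding D_def using mat_delete_carrier[OF A] by simp
  have Dij: "D $$ (i, j) = (if Suc i = j then x else 0) + (if i = j then - 1 else 0)"
    if "i < n" "j < n" for i j
    using that by (auto simp: mat_delete_def A_def D_def)
  have "det D = prod_list (diag_mat D)"
    by (rule det_upper_triangular[OF _ D]) (use D Dij in auto)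
  also have "diag_mat D = replicate n (- 1)"
    using D Dij by (auto simp: diag_mat_def intro!: nth_equalityI)
  also have "prod_list (replicate n (- 1 :: 'a)) = (- 1) ^ n" by simp
  finally have cn: "cofactor A 0 n = 1"
    by (simp add: cofactor_def D_def power_add[symmetric] flip: mult_2)
  have "det A = (\<Sum>j<Suc n. A $$ (0, j) * cofactor A 0 j)"
    by (rule laplace_expansion_row[OF A]) simp
  also have "\<dots> = (\<Sum>j\<in>{0, n}. A $$ (0, j) * cofactor A 0 j)"
    by (rule sum.mono_neutral_right) (auto simp: A_def)
  also have "\<dots> = x * cofactor A 0 0 + v 0 * cofactor A 0 n"
    using Suc.hyps by (simp add: A_def)
  also have "\<dots> = x ^ Suc n + (\<Sum>i<Suc n. v i * x ^ i)"
    unfolding c0 cn sum.lessThan_Suc_shift by (simp add: algebra_simps sum_distrib_left)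
  finally show ?case by (simp add: A_def)
qed

section \<open>The matrix mu Id + M_N(w)\<close>

definition char_matrix_M :: "nat \<Rightarrow> real vec \<Rightarrow> real \<Rightarrow> real mat" where
  "char_matrix_M N w \<mu> = \<mu> \<cdot>\<^sub>m 1\<^sub>m N + Mmat N w"

lemma char_matrix_M_carrier: "char_matrix_M N w \<mu> \<in> carrier_mat N N"
  by (simp add: char_matrix_M_def Mmat_def)

lemma char_matrix_M_index:
  "i < N \<Longrightarrow> j < N \<Longrightarrow> char_matrix_M N w \<mu> $$ (i, j) = (if i = j then \<mu> else 0) +
      (if j = N - 1 then w $ i else if i = j + 1 then - 1 else 0)"
  by (simp add: char_matrix_M_def Mmat_def)

text \<open>This is the polynomial w(mu) / mu, monic because
  \<open>w_ext N w (Suc N) = 1\<close>.\<close>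

lemma det_char_matrix_M:
  assumes "N \<ge> 1"
  shows "det (char_matrix_M N w \<mu>) = (\<Sum>k\<le>N. w_ext N w (Suc k) * \<mu> ^ k)"
proof -
  have "char_matrix_M N w \<mu> = mat N N (\<lambda>(i, j). (if i = j then \<mu> else 0) +
      (if j = N - 1 then w $ i else if i = j + 1 then - 1 else 0))"
    using char_matrix_M_carrier[of N w \<mu>] by (intro eq_matI) (auto simp: char_matrix_M_index)
  hence "det (char_matrix_M N w \<mu>) = \<mu> ^ N + (\<Sum>k<N. w $ k * \<mu> ^ k)"
    by (simp only: det_companion[OF assms])
  also have "(\<Sum>k<N. w $ k * \<mu> ^ k) = (\<Sum>k<N. w_ext N w (Suc k) * \<mu> ^ k)"
    by (rule sum.cong) (auto simp: w_ext_def)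
  finally show ?thesis by (simp add: lessThan_Suc_atMost[symmetric])
qed

text \<open>\<open>X\<close> holds the z-coefficients of the Bezoutian divided by mu. Row
  \<open>i\<close> reads mu x_(i+1) - x_i + w_(i+1) x_N; \<open>bezout_rec\<close> evaluates the
  first two terms, and by \<open>bezout_last\<close> the third cancels the multiple of g(mu) in
  them.\<close>

lemma char_matrix_M_mult_bezout:
  fixes N :: nat and w p :: "real vec" and \<mu> :: real
  defines "g \<equiv> contract N (p_ext N p) (w_ext N w)"
  defines "X \<equiv> vec N (\<lambda>n. \<Sum>k<N. bezout (w_ext N w) g (Suc k) (Suc n) * \<mu> ^ k)"
  assumes "N \<ge> 1" "p \<in> carrier_vec N"
  shows "char_matrix_M N w \<mu> *\<^sub>v X = det (char_matrix_M N w \<mu>) \<cdot>\<^sub>v (hankel N w *\<^sub>v p)"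
proof (rule eq_vecI)
  let ?W = "w_ext N w"
  let ?b = "bezout ?W g"
  have H: "hankel N w \<in> carrier_mat N N" by (simp add: hankel_def)
  show "dim_vec (char_matrix_M N w \<mu> *\<^sub>v X) = dim_vec (det (char_matrix_M N w \<mu>) \<cdot>\<^sub>v (hankel N w *\<^sub>v p))"
    using char_matrix_M_carrier[of N w \<mu>] H by simp
  fix i assume "i < dim_vec (det (char_matrix_M N w \<mu>) \<cdot>\<^sub>v (hankel N w *\<^sub>v p))"
  hence i: "i < N" using H by simp
  have last: "?b k N = g k" if "k \<ge> 1" for k
    by (rule bezout_last[OF that]) (auto simp: g_def intro!: contract_vanish)
  define x where "x = (\<lambda>n. \<Sum>k<N. ?b (Suc k) n * \<mu> ^ k)"
  have "(char_matrix_M N w \<mu> *\<^sub>v X) $ i = (\<Sum>j<N. char_matrix_M N w \<mu> $$ (i, j) * x (Suc j))"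
    using i char_matrix_M_carrier[of N w \<mu>]
    by (auto simp: X_def x_def scalar_prod_def atLeast0LessThan)
  \<comment> \<open>Row 0 has no subdiagonal entry, and \<open>i - 1\<close> truncates to 0 there,
    hence the inner case; it is consistent with \<open>x 0 = 0\<close>.\<close>
  also have "\<dots> = (\<Sum>j<N. (if i = j then \<mu> * x (Suc j) else 0)
      + (if j = N - 1 then w $ i * x (Suc j) else 0)
      - (if j = i - 1 then if i = 0 then 0 else x (Suc j) else 0))"
    using i by (intro sum.cong) (auto simp: char_matrix_M_index algebra_simps)
  also have "\<dots> = \<mu> * x (Suc i) + w $ i * x N - x i"
    using i assms(3) by (auto simp: sum.distrib sum_subtractf x_def)
  also have "\<mu> * x (Suc i) - x i = g (Suc i) * (\<Sum>k\<le>N. ?W (Suc k) * \<mu> ^ k)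
      - w $ i * (\<Sum>k<N. g (Suc k) * \<mu> ^ k)"
  proof -
    have "\<mu> * x (Suc i) = (\<Sum>k<N. ?b (Suc k) (Suc i) * \<mu> ^ Suc k)"
      by (simp add: x_def sum_distrib_left mult_ac)
    \<comment> \<open>Shifting the exponent adds a term at \<open>k = 0\<close>, zero by
      \<open>bezout_0\<close>, and exposes the top term \<open>k = N\<close>, known from
      \<open>last\<close> and symmetry.\<close>
    also have "\<dots> = (\<Sum>k<Suc N. ?b k (Suc i) * \<mu> ^ k)"
      unfolding sum.lessThan_Suc_shift by simp
    also have "\<dots> = (\<Sum>k<N. ?b k (Suc i) * \<mu> ^ k) + g (Suc i) * \<mu> ^ N"
      by (simp add: bezout_sym[of ?W g N "Suc i"] last)
    finally have "\<mu> * x (Suc i) - x i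
        = (\<Sum>k<N. (?b k (Suc i) - ?b (Suc k) i) * \<mu> ^ k) + g (Suc i) * \<mu> ^ N"
      by (simp add: x_def sum_subtractf left_diff_distrib)
    also have "(\<Sum>k<N. (?b k (Suc i) - ?b (Suc k) i) * \<mu> ^ k)
        = (\<Sum>k<N. (g (Suc i) * ?W (Suc k) - ?W (Suc i) * g (Suc k)) * \<mu> ^ k)"
      using bezout_rec[of "Suc _" "Suc i" ?W g] by simp
    also have "\<dots> = g (Suc i) * (\<Sum>k<N. ?W (Suc k) * \<mu> ^ k) - w $ i * (\<Sum>k<N. g (Suc k) * \<mu> ^ k)"
      using i by (simp add: w_ext_def[of N w "Suc i"] left_diff_distrib sum_subtractf sum_distrib_left mult.assoc)
    finally show ?thesis by (simp add: lessThan_Suc_atMost[symmetric] algebra_simps)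
  qed
  hence "\<mu> * x (Suc i) + w $ i * x N - x i = g (Suc i) * (\<Sum>k\<le>N. ?W (Suc k) * \<mu> ^ k)"
    using last by (simp add: x_def)
  finally show "(char_matrix_M N w \<mu> *\<^sub>v X) $ i =
      (det (char_matrix_M N w \<mu>) \<cdot>\<^sub>v (hankel N w *\<^sub>v p)) $ i"
    using i H assms(3,4) hankel_mult_index[OF assms(4) i, of w]
    by (simp add: det_char_matrix_M g_def mult.commute del: index_mult_mat_vec)
qed

text \<open>Applying the adjugate to \<open>char_matrix_M_mult_bezout\<close> leaves a factor det on
  both sides. It cancels off a finite set of mu, and both sides are continuous.\<close>

lemma gen_fun_integral_fn:
  assumes N: "N \<ge> 1" and x: "(w, p) \<in> cotangent N"
  shows "gen_fun N (w, p) \<mu> = (\<Sum>k<N. integral_fn N (w_ext N w) (p_ext N p) (Suc k) * \<mu> ^ k)"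
proof -
  let ?g = "contract N (p_ext N p) (w_ext N w)"
  let ?M = "char_matrix_M N w"
  define q where "q = (\<lambda>\<mu>. \<Sum>k<N. integral_fn N (w_ext N w) (p_ext N p) (Suc k) * \<mu> ^ k)"
  define X where "X = (\<lambda>\<mu>. vec N (\<lambda>n. \<Sum>k<N. bezout (w_ext N w) ?g (Suc k) (Suc n) * \<mu> ^ k))"
  have p: "p \<in> carrier_vec N" using x by (simp add: cotangent_def)
  have H: "hankel N w \<in> carrier_mat N N" by (simp add: hankel_def)
  have Hp: "hankel N w *\<^sub>v p \<in> carrier_vec N" using H p by simp
  have M: "?M \<mu> \<in> carrier_mat N N" for \<mu> by (rule char_matrix_M_carrier)
  have X: "X \<mu> \<in> carrier_vec N" for \<mu> by (simp add: X_def)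
  have gen: "gen_fun N (w, p) \<mu> = (adj_mat (?M \<mu>) *\<^sub>v (hankel N w *\<^sub>v p)) \<bullet> p" for \<mu>
    by (simp add: gen_fun_def char_matrix_M_def)
  have Xp: "X \<mu> \<bullet> p = q \<mu>" for \<mu>
  proof -
    have "X \<mu> \<bullet> p = (\<Sum>i<N. p $ i * (\<Sum>k<N. bezout (w_ext N w) ?g (Suc k) (i + 1) * \<mu> ^ k))"
      using p by (simp add: X_def scalar_prod_def atLeast0LessThan mult.commute)
    also have "\<dots> = (\<Sum>n=1..N. p_ext N p n * (\<Sum>k<N. bezout (w_ext N w) ?g (Suc k) n * \<mu> ^ k))"
      by (rule sum_p_ext)
    also have "\<dots> = q \<mu>"
      unfolding q_def integral_fn_def sum_distrib_left sum_distrib_right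
      by (subst sum.swap) (simp add: mult.assoc)
    finally show ?thesis .
  qed
  have smult_one: "(c \<cdot>\<^sub>m 1\<^sub>m N) *\<^sub>v v = c \<cdot>\<^sub>v v" if "v \<in> carrier_vec N" for c :: real and v
    using that by (intro eq_vecI) (auto simp: scalar_prod_def mult.assoc
        if_distrib[of "\<lambda>x. x * _"] if_distrib[of "\<lambda>x. _ * x"] cong: if_cong)
  have generic: "gen_fun N (w, p) \<mu> = q \<mu>" if d: "det (?M \<mu>) \<noteq> 0" for \<mu>
  proof -
    have "det (?M \<mu>) \<cdot>\<^sub>v X \<mu> = (adj_mat (?M \<mu>) * ?M \<mu>) *\<^sub>v X \<mu>"
      using X by (simp add: adj_mat(3)[OF M] smult_one)
    also have "\<dots> = adj_mat (?M \<mu>) *\<^sub>v (?M \<mu> *\<^sub>v X \<mu>)"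
      by (rule assoc_mult_mat_vec[OF adj_mat(1)[OF M] M X])
    also have "\<dots> = det (?M \<mu>) \<cdot>\<^sub>v (adj_mat (?M \<mu>) *\<^sub>v (hankel N w *\<^sub>v p))"
      unfolding X_def char_matrix_M_mult_bezout[OF N p]
      by (rule mult_mat_vec[OF adj_mat(1)[OF M] Hp])
    finally have "(det (?M \<mu>) \<cdot>\<^sub>v X \<mu>) \<bullet> p
        = (det (?M \<mu>) \<cdot>\<^sub>v (adj_mat (?M \<mu>) *\<^sub>v (hankel N w *\<^sub>v p))) \<bullet> p"
      by simp
    thus ?thesis
      using d p adj_mat(1)[OF M, of \<mu>] Hp X[of \<mu>] by (simp add: gen Xp)
  qed
  have "continuous_on UNIV (gen_fun N (w, p))"
  proof -
    have "gen_fun N (w, p) = (\<lambda>\<mu>. \<Sum>i<N. (\<Sum>j<N. cofactor (?M \<mu>) j i * (hankel N w *\<^sub>v p) $ j) * p $ i)"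
    proof
      fix \<mu>
      have "(adj_mat (?M \<mu>) *\<^sub>v v) \<bullet> p = (\<Sum>i<N. (\<Sum>j<N. cofactor (?M \<mu>) j i * v $ j) * p $ i)"
        if "v \<in> carrier_vec N" for v
        using p that by (simp add: adj_mat_def carrier_matD[OF M] scalar_prod_def atLeast0LessThan)
      from this[OF Hp] show "gen_fun N (w, p) \<mu> =
          (\<Sum>i<N. (\<Sum>j<N. cofactor (?M \<mu>) j i * (hankel N w *\<^sub>v p) $ j) * p $ i)"
        unfolding gen .
    qed
    moreover have "continuous_on UNIV (\<lambda>\<mu>. ?M \<mu> $$ (i, j))" if "i < N" "j < N" for i j
      using that by (cases "i = j") (auto simp: char_matrix_M_index intro!: continuous_intros)
    ultimately show ?thesis
      by (auto intro!: continuous_intros continuous_on_cofactor[of _ N] M)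
  qed
  hence "isCont (gen_fun N (w, p)) \<mu>" by (simp add: continuous_on_eq_continuous_at)
  hence lim: "(gen_fun N (w, p) \<longlongrightarrow> gen_fun N (w, p) \<mu>) (at \<mu>)" by (simp add: isCont_def)
  \<comment> \<open>The coefficient of mu^N is 1, so the polynomial is nonzero.\<close>
  have "finite {\<mu>. det (?M \<mu>) = 0}"
    unfolding det_char_matrix_M[OF N]
    by (rule polyfun_finite_roots[THEN iffD2]) (auto intro!: exI[of _ N])
  \<comment> \<open>A finite set has no limit points, so a punctured neighbourhood of mu avoids all
    roots, even if mu is itself one.\<close>
  hence "eventually (\<lambda>\<mu>. det (?M \<mu>) \<noteq> 0) (at \<mu>)"
    using islimpt_finite[of "{\<mu>. det (?M \<mu>) = 0}"] by (simp add: islimpt_iff_eventually)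
  hence "eventually (\<lambda>\<mu>. q \<mu> = gen_fun N (w, p) \<mu>) (at \<mu>)"
    by eventually_elim (simp add: generic)
  moreover have "(q \<longlongrightarrow> q \<mu>) (at \<mu>)"
    unfolding q_def by (intro tendsto_intros)
  ultimately have "(gen_fun N (w, p) \<longlongrightarrow> q \<mu>) (at \<mu>)"
    by (rule Lim_transform_eventually[rotated])
  with lim have "gen_fun N (w, p) \<mu> = q \<mu>"
    by (intro tendsto_unique[of "at \<mu>"]) auto
  thus ?thesis by (simp add: q_def)
qed

text \<open>A real polynomial function determines its coefficients, and the value 0 outside
  \<open>1..N\<close> makes the described sequence unique.\<close>

lemma geo_integral_eqI:
  assumes "\<And>\<mu>. gen_fun N x \<mu> = (\<Sum>k<N. c (Suc k) * \<mu> ^ k)" "k \<in> {1..N}"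
  shows "geo_integral N k x = c k"
proof -
  have re: "(\<Sum>k=1..N. d k * \<mu> ^ (k - 1)) = (\<Sum>k<N. d (Suc k) * \<mu> ^ k)" for d and \<mu> :: real
    by (rule sum.reindex_bij_witness[of _ Suc "\<lambda>k. k - 1"]) auto
  have "(THE d. (\<forall>k. k \<notin> {1..N} \<longrightarrow> d k = 0) \<and>
     (\<forall>\<mu>. (\<Sum>k=1..N. d k * \<mu> ^ (k - 1)) = gen_fun N x \<mu>)) = (\<lambda>k. if k \<in> {1..N} then c k else 0)"
    unfolding re
  proof (rule the_equality, goal_cases)
    case 1
    show ?case by (auto simp: assms(1) intro!: sum.cong)
  next
    case (2 d)
    have "\<forall>\<mu>. (\<Sum>k<N. (d (Suc k) - c (Suc k)) * \<mu> ^ k) = 0"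
      using 2 by (simp add: assms(1) left_diff_distrib sum_subtractf)
    hence "\<forall>\<mu>. (\<Sum>k\<le>N - 1. (d (Suc k) - c (Suc k)) * \<mu> ^ k) = 0"
      using assms(2) by (simp add: lessThan_Suc_atMost[symmetric])
    hence eq: "d (Suc k) = c (Suc k)" if "k \<le> N - 1" for k
      using that unfolding polyfun_eq_0 by auto
    show ?case
    proof (rule ext)
      fix k show "d k = (if k \<in> {1..N} then c k else 0)"
        using 2 eq[of "k - 1"] by (cases "k \<in> {1..N}") auto
    qed
  qed
  thus ?thesis using assms(2) by (simp add: geo_integral_def)
qed

theorem corollary8p2:
  fixes N :: nat
  assumes "N \<ge> 2"
  shows "hamiltonian_flow N (H_tilde N) = geodesic_flow N \<and>
    (\<forall>(w, p)\<in>cotangent N.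
       Ham (ident N (w, p)) = of_real (H_tilde N (w, p)) \<and>
       H_tilde N (w, p) = (\<Sum>j<N. \<Sum>k<N. hankel N w $$ (j, k) * p $ j * p $ k) \<and>
       H_tilde N (w, p) = cometric N (w, p)) \<and>
    (\<forall>x\<in>cotangent N. \<forall>\<mu>.
       (\<Sum>k=1..N. geo_integral N k x * \<mu> ^ (k - 1)) = gen_fun N x \<mu>) \<and>
    (\<forall>k\<in>{1..N}. first_integral (geodesic_flow N) (geo_integral N k)) \<and>
    (\<forall>k\<in>{1..N}. \<forall>x\<in>cotangent N. Iint k (ident N x) = of_real (geo_integral N k x))"
proof -
  \<comment> \<open>Both families of integrals are reduced to this expression, \<open>Iint\<close>
    by Fourier coefficients and \<open>geo_integral\<close> by the generating function.\<close>
  let ?I = "\<lambda>k (w, p). integral_fn N (w_ext N w) (p_ext N p) k"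
  have H: "H_tilde N (w, p) = ham_fn N (w_ext N w) (p_ext N p)" if "(w, p) \<in> cotangent N" for w p
    by (simp add: H_tilde_def Ham_ident[OF that])
  have gen: "gen_fun N x \<mu> = (\<Sum>k<N. ?I (Suc k) x * \<mu> ^ k)" if "x \<in> cotangent N" for x \<mu>
    using gen_fun_integral_fn[of N "fst x" "snd x" \<mu>] that assms by (simp add: case_prod_beta)
  have geo: "geo_integral N k x = ?I k x" if "x \<in> cotangent N" "k \<in> {1..N}" for k x
    by (rule geo_integral_eqI[OF gen[OF that(1)] that(2)])
  have "hamiltonian_flow N (H_tilde N) = geodesic_flow N"
    unfolding geodesic_flow_def by (rule hamiltonian_flow_cong) (auto simp: H cometric_ham_fn)
  moreover have "\<forall>(w, p)\<in>cotangent N.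
       Ham (ident N (w, p)) = of_real (H_tilde N (w, p)) \<and>
       H_tilde N (w, p) = (\<Sum>j<N. \<Sum>k<N. hankel N w $$ (j, k) * p $ j * p $ k) \<and>
       H_tilde N (w, p) = cometric N (w, p)"
    by (auto simp: H Ham_ident cometric_ham_fn ham_fn_hankel cotangent_def)
  moreover have "(\<Sum>k=1..N. geo_integral N k x * \<mu> ^ (k - 1)) = gen_fun N x \<mu>"
    if "x \<in> cotangent N" for x \<mu>
  proof -
    have "(\<Sum>k=1..N. geo_integral N k x * \<mu> ^ (k - 1)) = (\<Sum>k<N. ?I (Suc k) x * \<mu> ^ k)"
      by (rule sum.reindex_bij_witness[of _ Suc "\<lambda>k. k - 1"]) (auto simp: geo[OF that])
    thus ?thesis by (simp add: gen[OF that])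
  qed
  moreover have "first_integral (geodesic_flow N) (geo_integral N k)" if "k \<in> {1..N}" for k
    unfolding geodesic_flow_def
    by (rule first_integral_fn[where k = k]) (simp_all add: cometric_ham_fn geo[OF _ that])
  moreover have "Iint k (ident N x) = of_real (geo_integral N k x)"
    if "k \<in> {1..N}" "x \<in> cotangent N" for k x
    using Iint_ident[of "fst x" "snd x" N k] that by (simp add: geo case_prod_beta)
  ultimately show ?thesis by blast
qed

end
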